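(* Let $a_2>a_1>0$, $c>0$, $A=a_2/a_1>1$, $K_2\in(0,1)$ and $n\in\mathbb{N}_0$. Let $G_{nm}$, $m^0(n)$, $m^*(n)$, $m^{**}(n)$, $L_{nm}$ and the notion of unimodal $(n,m)$-solution at $K_1$ (for the equation $\epsilon\dot u(t)=-u(t)-K_1u(t-a_1-cu(t))-K_2u(t-a_2-cu(t))$) be as defined in the context. When $G_{nm}(K)$ has distinct roots denote them $M_{nm}^-<M_{nm}^+$, and let $M_{nm}$ be the root of $G_{nm}(K)$ when it has a unique root. (i) For $m=m^0(n)\in(n(A-1)-1,n(A-1)]$: if $m^0(n)<n(A-1)$, then for any $A>1$ there is a unimodal $(n,m)$-solution for all $K_1>\max\{L_{nm},M_{nm}^+\}$; if $m^0(n)=n(A-1)$ and $A>1+\frac{K_2}{1+K_2}$, then there is a unimodal $(n,m)$-solution for all $K_1>\max\{L_{00},M_{00}\}$. (ii) For each integer $m\in(n(A-1),m^*(n))$ there is a unimodal $(n,m)$-solution for all $K_1\in(L_{nm},M_{nm}^+)$, where $1<L_{nm}<M_{nm}^+<\infty$. (iii) If $m=m^*(n)>m^0(n)$ (with $m$ an integer), then there is a unimodal $(n,m)$-solution for all $K_1\in(1,M_{nm}^+)$, where $1=L_{nm}=M_{nm}^-<M_{nm}^+$. (iv) If $A>1+\frac{K_2}{1+K_2}$, then for each integer $m>m^0(n)$ with $m\in(m^*(n),m^{**}(n))$ we have $1\le M_{nm}^-<M_{nm}^+<+\infty$ and there is a unimodal $(n,m)$-solution for all $K_1\in(M_{nm}^-,M_{nm}^+)$.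 (v) If $m<m^0(n)$ or $m\ge m^{**}(n)$, there is no $K_1$ at which there is a unimodal $(n,m)$-solution.
   Context: $\mathbb{N}_0=\{0,1,2,\dots\}$; $m\in\mathbb{N}_0$ throughout. Definitions: $$G_{nm}(K_1)=\bigl[m-n(A-1)\bigr]\bigl((K_1+K_2)^2-1\bigr)-K_1\bigl[(A-1)(1+K_2)-K_2\bigr]+K_2(1+K_2)+(A-1),$$ a polynomial in $K_1$ of degree at most two. $m^0(n)$ is the unique integer in $(n(A-1)-1,n(A-1)]$. $$m^*(n)=n(A-1)+\frac{A-3-K_2}{2+K_2},\qquad L_{nm}=\frac{A-1}{m-n(A-1)+1}-(1+K_2)\quad(\text{for } m>n(A-1)-1),$$ $$m^{**}(n)=n(A-1)+\tfrac12\bigl[(A-1)\bigl((1+K_2)^2-K_2\bigr)+K_2\bigr]-\tfrac12\sqrt{\bigl(1+(1+K_2)^2\bigr)\bigl(((A-1)K_2+1)^2-1\bigr)}.$$ Unimodal $(n,m)$-solution at $K_1$: we say there is a unimodal $(n,m)$-solution at $K_1$ if the following unimodal conditions hold: $K_1>1$ and, with $$T=\frac{a_1(1+K_1+K_2)+(a_2-a_1)K_2}{1+(m+1)K_2+n(1+K_1+K_2)},\qquad \theta=\frac{a_2-a_1}{T}-m,$$ one has $\theta\in\left(\frac{K_2}{K_1+K_2-1},1\right)$; and the equation has a periodic singular solution (defined below) of period $T$ with sawtooth profile $\Gamma(\mu)=(t(\mu),u(\mu))$, $\mu\in\mathbb{R}$: for each $i\in\mathbb{Z}$, $t(\mu)=(\mu-i)T$,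 $u(\mu)=\frac1c(-a_1+(n+\mu-2i)T)$ for $\mu\in[2i,2i+1]$, and $t(\mu)=(i+1)T$, $u(\mu)=\frac1c(-a_1+(n+1-(\mu-2i-1))T)$ for $\mu\in(2i+1,2i+2)$. Admissible singular solution profile: a continuous injective parametric curve $\Gamma:I\to\mathbb{R}^2$, $\Gamma(\mu)=(t(\mu),u(\mu))$, on a nonempty interval $I\subseteq\mathbb{R}$, with $t$ monotonically increasing (not necessarily strictly). The interval $I$ is partitioned as $I=I^+\cup I^-\cup I^*$, where $I^*$ is a disjoint union of open intervals on each of which $t$ is strictly increasing, and $I^{\pm}$ are disjoint unions of closed intervals on each of which $t$ is constant, with $u$ strictly decreasing on each interval of $I^-$ and strictly increasing on each interval of $I^+$. Singular solution of $\epsilon\dot u(t)=-u(t)-K_1u(t-a_1-cu(t))-K_2u(t-a_2-cu(t))$ (an $\epsilon=0$ notion): let $\Gamma$ be an admissible singular solution profile on $I$, $J\subseteq\mathbb{R}$ a nonempty interval, and $\mu_0,\mu_1,\mu_2:J\to I$ continuous with $\mu_0$ monotonically increasing. Set $J^*=\mathrm{cl}\{\eta:\mu_0(\eta)\in I^*\}$, $J^\pm=\mathrm{int}\{\eta:\mu_0(\eta)\in I^\pm\}$ and $F(\eta)=-u(\mu_0(\eta))-K_1u(\mu_1(\eta))-K_2u(\mu_2(\eta))$. Then $\{\Gamma,\mu_0,\mu_1,\mu_2\}$ is a singular solution on $t(\mu_0(J))$ if $t(\mu_i(\eta))=t(\mu_0(\eta))-a_i-cu(\mu_0(\eta))$ for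 all $\eta\in J$, $i=1,2$, and $F=0$ on $J^*$, $F<0$ on $J^-$, $F>0$ on $J^+$. It is periodic if $J=\mathbb{R}$ and there exist $T>0$, $\eta_T>0$ with $t(\mu_i(\eta+\eta_T))=t(\mu_i(\eta))+T$ and $u(\mu_i(\eta+\eta_T))=u(\mu_i(\eta))$ for all $i=0,1,2$ and $\eta\in\mathbb{R}$; the period is the smallest such $T$. *)

theory Defs
  imports "HOL-Analysis.Analysis"
begin

text \<open>
  We consider \<open>\<epsilon> u'(t) = - u(t) - K1 u(t - a1 - c u(t)) - K2 u(t - a2 - c u(t))\<close> in the
  singular limit \<open>\<epsilon> = 0\<close>. A parametric curve is a function \<open>\<Gamma>\<close> whose components
  \<open>fst (\<Gamma> \<mu>)\<close> and \<open>snd (\<Gamma> \<mu>)\<close> are \<open>t(\<mu>)\<close> and \<open>u(\<mu>)\<close>.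

  Conventions in the next definition: open and closed mean open and closed relative to \<open>I\<close> (no
  difference for \<open>I = \<real>\<close>), and the closed intervals are nondegenerate. Singletons must
  be excluded: \<open>t\<close> is constant and \<open>u\<close> strictly monotone on any singleton, so every subset of
  \<open>I\<close> would qualify as \<open>I\<^sup>+\<close> or \<open>I\<^sup>-\<close>.
\<close>

definition admissible_profile ::
  "(real \<Rightarrow> real \<times> real) \<Rightarrow> real set \<Rightarrow> real set \<Rightarrow> real set \<Rightarrow> real set \<Rightarrow> bool"
where
  "admissible_profile \<Gamma> I Iplus Iminus Istar \<longleftrightarrow>
     is_interval I \<and> I \<noteq> {} \<and>
     continuous_on I \<Gamma> \<and> inj_on \<Gamma> I \<and> mono_on I (\<lambda>\<mu>. fst (\<Gamma> \<mu>)) \<and>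
     I = Iplus \<union> Iminus \<union> Istar \<and> disjnt Iplus Iminus \<and> disjnt Iplus Istar \<and> disjnt Iminus Istar \<and>
     (\<exists>\<V>. disjoint \<V> \<and> Istar = \<Union>\<V> \<and>
        (\<forall>V\<in>\<V>. V \<noteq> {} \<and> is_interval V \<and> openin (top_of_set I) V \<and>
           strict_mono_on V (\<lambda>\<mu>. fst (\<Gamma> \<mu>)))) \<and>
     (\<exists>\<V>. disjoint \<V> \<and> Iminus = \<Union>\<V> \<and>
        (\<forall>V\<in>\<V>. (\<exists>x\<in>V. \<exists>y\<in>V. x < y) \<and> is_interval V \<and> closedin (top_of_set I) V \<and>
           (\<lambda>\<mu>. fst (\<Gamma> \<mu>)) constant_on V \<and> strict_antimono_on V (\<lambda>\<mu>. snd (\<Gamma> \<mu>)))) \<and>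
     (\<exists>\<V>. disjoint \<V> \<and> Iplus = \<Union>\<V> \<and>
        (\<forall>V\<in>\<V>. (\<exists>x\<in>V. \<exists>y\<in>V. x < y) \<and> is_interval V \<and> closedin (top_of_set I) V \<and>
           (\<lambda>\<mu>. fst (\<Gamma> \<mu>)) constant_on V \<and> strict_mono_on V (\<lambda>\<mu>. snd (\<Gamma> \<mu>))))"

definition defect ::
  "real \<Rightarrow> real \<Rightarrow> (real \<Rightarrow> real \<times> real) \<Rightarrow> (real \<Rightarrow> real) \<Rightarrow> (real \<Rightarrow> real) \<Rightarrow> (real \<Rightarrow> real) \<Rightarrow> real \<Rightarrow> real"
where
  "defect K1 K2 \<Gamma> \<mu>0 \<mu>1 \<mu>2 \<eta> =
     - snd (\<Gamma> (\<mu>0 \<eta>)) - K1 * snd (\<Gamma> (\<mu>1 \<eta>)) - K2 * snd (\<Gamma> (\<mu>2 \<eta>))"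

definition singular_solution ::
  "real \<Rightarrow> real \<Rightarrow> real \<Rightarrow> real \<Rightarrow> real \<Rightarrow> (real \<Rightarrow> real \<times> real) \<Rightarrow>
   real set \<Rightarrow> real set \<Rightarrow> real set \<Rightarrow> real set \<Rightarrow> real set \<Rightarrow>
   (real \<Rightarrow> real) \<Rightarrow> (real \<Rightarrow> real) \<Rightarrow> (real \<Rightarrow> real) \<Rightarrow> bool"
where
  "singular_solution a1 a2 c K1 K2 \<Gamma> I Iplus Iminus Istar J \<mu>0 \<mu>1 \<mu>2 \<longleftrightarrow>
     admissible_profile \<Gamma> I Iplus Iminus Istar \<and>
     is_interval J \<and> J \<noteq> {} \<and>
     (\<forall>\<mu>\<in>{\<mu>0, \<mu>1, \<mu>2}. continuous_on J \<mu> \<and> \<mu> ` J \<subseteq> I) \<and> mono_on J \<mu>0 \<and>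
     (\<forall>\<eta>\<in>J. fst (\<Gamma> (\<mu>1 \<eta>)) = fst (\<Gamma> (\<mu>0 \<eta>)) - a1 - c * snd (\<Gamma> (\<mu>0 \<eta>)) \<and>
            fst (\<Gamma> (\<mu>2 \<eta>)) = fst (\<Gamma> (\<mu>0 \<eta>)) - a2 - c * snd (\<Gamma> (\<mu>0 \<eta>))) \<and>
     (\<forall>\<eta>\<in>J \<inter> closure {\<eta>\<in>J. \<mu>0 \<eta> \<in> Istar}. defect K1 K2 \<Gamma> \<mu>0 \<mu>1 \<mu>2 \<eta> = 0) \<and>
     (\<forall>\<eta>\<in>interior {\<eta>\<in>J. \<mu>0 \<eta> \<in> Iminus}. defect K1 K2 \<Gamma> \<mu>0 \<mu>1 \<mu>2 \<eta> < 0) \<and>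
     (\<forall>\<eta>\<in>interior {\<eta>\<in>J. \<mu>0 \<eta> \<in> Iplus}. defect K1 K2 \<Gamma> \<mu>0 \<mu>1 \<mu>2 \<eta> > 0)"

definition translation_periods ::
  "(real \<Rightarrow> real \<times> real) \<Rightarrow> (real \<Rightarrow> real) \<Rightarrow> (real \<Rightarrow> real) \<Rightarrow> (real \<Rightarrow> real) \<Rightarrow> real set"
where
  "translation_periods \<Gamma> \<mu>0 \<mu>1 \<mu>2 =
     {T. T > 0 \<and> (\<exists>\<eta>T>0. \<forall>\<mu>\<in>{\<mu>0, \<mu>1, \<mu>2}. \<forall>\<eta>.
          fst (\<Gamma> (\<mu> (\<eta> + \<eta>T))) = fst (\<Gamma> (\<mu> \<eta>)) + T \<and>
          snd (\<Gamma> (\<mu> (\<eta> + \<eta>T))) = snd (\<Gamma> (\<mu> \<eta>)))}"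

definition periodic_singular_solution ::
  "real \<Rightarrow> real \<Rightarrow> real \<Rightarrow> real \<Rightarrow> real \<Rightarrow> (real \<Rightarrow> real \<times> real) \<Rightarrow>
   real set \<Rightarrow> real set \<Rightarrow> real set \<Rightarrow> real set \<Rightarrow>
   (real \<Rightarrow> real) \<Rightarrow> (real \<Rightarrow> real) \<Rightarrow> (real \<Rightarrow> real) \<Rightarrow> real \<Rightarrow> bool"
where
  "periodic_singular_solution a1 a2 c K1 K2 \<Gamma> I Iplus Iminus Istar \<mu>0 \<mu>1 \<mu>2 T \<longleftrightarrow>
     singular_solution a1 a2 c K1 K2 \<Gamma> I Iplus Iminus Istar UNIV \<mu>0 \<mu>1 \<mu>2 \<and>
     T \<in> translation_periods \<Gamma> \<mu>0 \<mu>1 \<mu>2 \<and>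
     (\<forall>T'\<in>translation_periods \<Gamma> \<mu>0 \<mu>1 \<mu>2. T \<le> T')"

text \<open>The index \<open>i\<close> below is the integer with \<open>\<mu> \<in> [2i, 2i + 2)\<close>.\<close>

definition sawtooth :: "real \<Rightarrow> real \<Rightarrow> nat \<Rightarrow> real \<Rightarrow> real \<Rightarrow> real \<times> real" where
  "sawtooth a1 c n T \<mu> =
     (let i = real_of_int \<lfloor>\<mu> / 2\<rfloor> in
      if \<mu> \<le> 2 * i + 1
      then ((\<mu> - i) * T, (1 / c) * (- a1 + (real n + \<mu> - 2 * i) * T))
      else ((i + 1) * T, (1 / c) * (- a1 + (real n + 1 - (\<mu> - 2 * i - 1)) * T)))"

definition unimodal_T :: "real \<Rightarrow> real \<Rightarrow> real \<Rightarrow> real \<Rightarrow> nat \<Rightarrow> nat \<Rightarrow> real" where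
  "unimodal_T a1 a2 K1 K2 n m =
     (a1 * (1 + K1 + K2) + (a2 - a1) * K2) /
     (1 + (real m + 1) * K2 + real n * (1 + K1 + K2))"

definition unimodal_theta :: "real \<Rightarrow> real \<Rightarrow> real \<Rightarrow> real \<Rightarrow> nat \<Rightarrow> nat \<Rightarrow> real" where
  "unimodal_theta a1 a2 K1 K2 n m = (a2 - a1) / unimodal_T a1 a2 K1 K2 n m - real m"

definition unimodal_solution_at ::
  "real \<Rightarrow> real \<Rightarrow> real \<Rightarrow> real \<Rightarrow> nat \<Rightarrow> nat \<Rightarrow> real \<Rightarrow> bool"
where
  "unimodal_solution_at a1 a2 c K2 n m K1 \<longleftrightarrow>
     K1 > 1 \<and>
     unimodal_theta a1 a2 K1 K2 n m \<in> {K2 / (K1 + K2 - 1) <..< 1} \<and>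
     (let T = unimodal_T a1 a2 K1 K2 n m in
      \<exists>Iplus Iminus Istar \<mu>0 \<mu>1 \<mu>2.
        periodic_singular_solution a1 a2 c K1 K2 (sawtooth a1 c n T) UNIV Iplus Iminus Istar \<mu>0 \<mu>1 \<mu>2 T)"

definition G_nm :: "real \<Rightarrow> real \<Rightarrow> nat \<Rightarrow> nat \<Rightarrow> real \<Rightarrow> real" where
  "G_nm A K2 n m K1 =
     (real m - real n * (A - 1)) * ((K1 + K2)^2 - 1)
     - K1 * ((A - 1) * (1 + K2) - K2) + K2 * (1 + K2) + (A - 1)"

definition G_distinct_roots :: "real \<Rightarrow> real \<Rightarrow> nat \<Rightarrow> nat \<Rightarrow> bool" where
  "G_distinct_roots A K2 n m \<longleftrightarrow> (\<exists>r s. r < s \<and> {K. G_nm A K2 n m K = 0} = {r, s})"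

text \<open>
  \<open>M_minus\<close> and \<open>M_plus\<close> are meaningful only under \<open>G_distinct_roots\<close>, \<open>M_root\<close> only when \<open>G_nm\<close>
  has exactly one root, and \<open>L_nm\<close> only for \<open>m > n (A - 1) - 1\<close>.
\<close>

definition M_minus :: "real \<Rightarrow> real \<Rightarrow> nat \<Rightarrow> nat \<Rightarrow> real" where
  "M_minus A K2 n m = Min {K. G_nm A K2 n m K = 0}"

definition M_plus :: "real \<Rightarrow> real \<Rightarrow> nat \<Rightarrow> nat \<Rightarrow> real" where
  "M_plus A K2 n m = Max {K. G_nm A K2 n m K = 0}"

definition M_root :: "real \<Rightarrow> real \<Rightarrow> nat \<Rightarrow> nat \<Rightarrow> real" where
  "M_root A K2 n m = (THE K. G_nm A K2 n m K = 0)"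

definition L_nm :: "real \<Rightarrow> real \<Rightarrow> nat \<Rightarrow> nat \<Rightarrow> real" where
  "L_nm A K2 n m = (A - 1) / (real m - real n * (A - 1) + 1) - (1 + K2)"

definition m_zero :: "real \<Rightarrow> nat \<Rightarrow> int" where
  "m_zero A n = (THE m. real_of_int m \<in> {real n * (A - 1) - 1 <.. real n * (A - 1)})"

definition m_star :: "real \<Rightarrow> real \<Rightarrow> nat \<Rightarrow> real" where
  "m_star A K2 n = real n * (A - 1) + (A - 3 - K2) / (2 + K2)"

definition m_star_star :: "real \<Rightarrow> real \<Rightarrow> nat \<Rightarrow> real" where
  "m_star_star A K2 n =
     real n * (A - 1) + 1/2 * ((A - 1) * ((1 + K2)^2 - K2) + K2)
     - 1/2 * sqrt ((1 + (1 + K2)^2) * (((A - 1) * K2 + 1)^2 - 1))"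

end

theory Submission
  imports Defs
begin

text \<open>
  The sawtooth is tuned so that the delayed arguments are easy to follow. Along a rising segment
  \<open>t - a1 - c u\<close> is constant and equal to a jump time, while \<open>t - a2 - c u\<close> is constant and lies a
  fraction \<open>1 - \<theta>\<close> of a period after a jump. Along a falling segment \<open>t\<close> stands still and both
  delayed arguments advance by one period. So on a rise the equation can be balanced by moving \<open>\<mu>1\<close>
  down a vertical segment, by the \<open>1 / K1\<close>-th part of it; the value of \<open>T\<close> says precisely that \<open>\<mu>1\<close>
  reaches the lower end when the rise ends. On a fall, in units of \<open>T / c\<close>, the defect starts at \<open>0\<close>,
  decreases at the rate \<open>K1 + K2 - 1\<close>, and gains \<open>K2\<close> when the second delayed argument crosses a
  jump, which happens after a fraction \<open>\<theta>\<close> of the fall. For \<open>K1 > 1\<close> it stays negative iff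
  \<open>\<theta> > K2 / (K1 + K2 - 1)\<close>. Hence the periodic singular solution exists as soon as \<open>K1 > 1\<close> and \<open>\<theta>\<close>
  is in the prescribed interval (\<open>periodic_singular_solution_sawtooth\<close>), and the existence question
  is one about \<open>\<theta>\<close> only.

  With \<open>\<delta> = m - n (A - 1)\<close> the two bounds on \<open>\<theta>\<close> become, after clearing denominators,
  \<open>A - 1 < (\<delta> + 1) (1 + K1 + K2)\<close>, that is \<open>K1 > L\<close> when \<open>\<delta> > -1\<close>, and \<open>G K1 < 0\<close>
  (\<open>unimodal_solution_iff\<close>). What remains is the position of the roots of the quadratic \<open>G\<close>
  relative to \<open>1\<close> and \<open>L\<close>. For \<open>\<delta> > -1\<close>, three facts decide it. First,
  \<open>G 1 = K2 ((\<delta> + 1) (2 + K2) - (A - 1))\<close>, so \<open>G 1\<close> has the sign of \<open>1 - L\<close> and vanishes exactly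
  at \<open>m = m\<^sup>*\<close>. Second, \<open>G L < 0\<close> if \<open>L > 1\<close>, because \<open>K1 = L\<close> means \<open>\<theta> = 1\<close>. Third, the
  discriminant of \<open>G\<close> is itself quadratic in \<open>\<delta>\<close>, and \<open>m\<^sup>*\<^sup>*\<close> corresponds to its smaller root: for
  \<open>m < m\<^sup>*\<^sup>*\<close>, if \<open>\<delta> > 0\<close> and \<open>A > 1 + K2 / (1 + K2)\<close>, there are two roots with mean greater than \<open>1\<close>
  (\<open>below_m_star_star\<close>), while for \<open>m \<ge> m\<^sup>*\<^sup>*\<close> the polynomial \<open>G\<close> is nonnegative on \<open>(1, \<infinity>)\<close>
  (\<open>G_nm_nonneg_above_m_star_star\<close>).
\<close>

section \<open>Equivariant extensions\<close>

text \<open>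
  For \<open>f P = f 0 + q\<close> this is the unique extension \<open>g\<close> of \<open>f\<close> from \<open>[0, P]\<close> to the line with
  \<open>g (x + P) = g x + q\<close>. The staircase \<open>t(\<mu>) / T\<close> and the parametrizations \<open>\<mu>0, \<mu>1, \<mu>2\<close> are of
  this form, so that continuity, monotonicity and every identity need checking on a single cell only.
\<close>

definition equivariant_extension :: "real \<Rightarrow> real \<Rightarrow> (real \<Rightarrow> real) \<Rightarrow> real \<Rightarrow> real" where
  "equivariant_extension P q f x =
     q * of_int \<lfloor>x / P\<rfloor> + f (x - P * of_int \<lfloor>x / P\<rfloor>)"

lemma floor_cell:
  fixes P x :: real
  assumes "P > 0"
  obtains j :: int and s where "x = P * of_int j + s" "0 \<le> s" "s < P"
proof
  show "x = P * of_int \<lfloor>x / P\<rfloor> + (x - P * of_int \<lfloor>x / P\<rfloor>)" by simp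
  show "0 \<le> x - P * of_int \<lfloor>x / P\<rfloor>"
    using of_int_floor_le[of "x / P"] assms
    by (simp only: pos_le_divide_eq mult.commute[of P] diff_ge_0_iff_ge)
  show "x - P * of_int \<lfloor>x / P\<rfloor> < P"
    using floor_correct[of "x / P"] assms by (simp add: field_simps)
qed

text \<open>
  The closed cell is the useful form: both formulas for the value at a cell boundary are available,
  and \<open>f P = f 0 + q\<close> is what makes them agree.
\<close>

lemma equivariant_extension_cell:
  assumes P: "P > 0" and f: "f P = f 0 + q" and s: "0 \<le> s" "s \<le> P"
  shows "equivariant_extension P q f (P * of_int j + s) = q * of_int j + f s"
proof (cases "s = P")
  case True
  then have "(P * of_int j + s) / P = of_int (j + 1)" using P by (simp add: field_simps)
  then have "\<lfloor>(P * of_int j + s) / P\<rfloor> = j + 1" by (metis floor_of_int)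
  then show ?thesis using True f by (simp add: equivariant_extension_def algebra_simps)
next
  case False
  then have "\<lfloor>(P * of_int j + s) / P\<rfloor> = j"
    using P s by (intro floor_unique) (auto simp: field_simps)
  then show ?thesis by (simp add: equivariant_extension_def)
qed

lemma equivariant_extension_shift:
  assumes "P > 0"
  shows "equivariant_extension P q f (x + P) = equivariant_extension P q f x + q"
proof -
  have "(x + P) / P = x / P + 1" using assms by (simp add: field_simps)
  then have "\<lfloor>(x + P) / P\<rfloor> = \<lfloor>x / P\<rfloor> + 1" by simp
  then show ?thesis by (simp add: equivariant_extension_def algebra_simps)
qed

text \<open>
  On each closed cell the extension is a translate of \<open>f\<close>, and every point is interior to the union
  of two neighbouring cells.
\<close>

lemma continuous_equivariant_extension:
  assumes P: "P > 0" and f: "f P = f 0 + q" and cont: "continuous_on {0..P} f"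
  shows "continuous_on UNIV (equivariant_extension P q f)"
proof -
  let ?g = "equivariant_extension P q f"
  have cell: "continuous_on {P * of_int j .. P * of_int j + P} ?g" for j :: int
  proof -
    have "continuous_on {P * of_int j .. P * of_int j + P} (\<lambda>x. q * of_int j + f (x - P * of_int j))"
      by (intro continuous_intros continuous_on_compose2[OF cont]) auto
    then show ?thesis
    proof (rule continuous_on_eq)
      fix x assume "x \<in> {P * of_int j .. P * of_int j + P}"
      then show "q * of_int j + f (x - P * of_int j) = ?g x"
        using equivariant_extension_cell[where s = "x - P * of_int j" and j = j, OF P f] by simp
    qed
  qed
  have "isCont ?g x" for x
  proof -
    obtain j s where x: "x = P * of_int j + s" "0 \<le> s" "s < P" by (rule floor_cell[OF P])
    have "continuous_on ({P * of_int (j-1) .. P * of_int (j-1) + P} \<union>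
                        {P * of_int j .. P * of_int j + P}) ?g"
      by (intro continuous_on_closed_Un cell) auto
    moreover have "{P * of_int (j-1) <..< P * of_int j + P} \<subseteq>
        {P * of_int (j-1) .. P * of_int (j-1) + P} \<union> {P * of_int j .. P * of_int j + P}"
      by (auto simp: algebra_simps)
    ultimately have "continuous_on {P * of_int (j-1) <..< P * of_int j + P} ?g"
      by (rule continuous_on_subset)
    then show ?thesis
      using x P by (subst (asm) continuous_on_eq_continuous_at) (auto simp: algebra_simps)
  qed
  then show ?thesis by (simp add: continuous_at_imp_continuous_on)
qed

lemma mono_equivariant_extension:
  assumes P: "P > 0" and f: "f P = f 0 + q" and m: "mono_on {0..P} f"
  shows "mono (equivariant_extension P q f)"
proof (rule monoI)
  fix x y :: real assume xy: "x \<le> y"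
  obtain j s where x: "x = P * of_int j + s" "0 \<le> s" "s < P" by (rule floor_cell[OF P])
  obtain k r where y: "y = P * of_int k + r" "0 \<le> r" "r < P" by (rule floor_cell[OF P])
  have gx: "equivariant_extension P q f x = q * of_int j + f s"
    using x equivariant_extension_cell[OF P f] by simp
  have gy: "equivariant_extension P q f y = q * of_int k + f r"
    using y equivariant_extension_cell[OF P f] by simp
  have "P * of_int j < P * (of_int k + 1)" using xy x y by (simp add: algebra_simps)
  then have jk: "j \<le> k" using P by simp
  have q: "q \<ge> 0" using f P mono_onD[OF m, of 0 P] by simp
  show "equivariant_extension P q f x \<le> equivariant_extension P q f y"
  proof (cases "j = k")
    case True
    then show ?thesis using gx gy x y xy mono_onD[OF m, of s r] by simp
  next
    case False
    then have "q * of_int j + q \<le> q * of_int k"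
      using jk q mult_left_mono[of "of_int j + 1" "of_int k" q] by (simp add: algebra_simps)
    moreover have "f s \<le> f 0 + q" using mono_onD[OF m, of s P] x f by simp
    moreover have "f 0 \<le> f r" using mono_onD[OF m, of 0 r] y by simp
    ultimately show ?thesis using gx gy by linarith
  qed
qed

section \<open>The sawtooth as an admissible profile\<close>

text \<open>
  The first component of the sawtooth, in units of \<open>T\<close>.
\<close>

definition staircase :: "real \<Rightarrow> real" where
  "staircase = equivariant_extension 2 1 (min 1)"

lemma continuous_staircase: "continuous_on UNIV staircase"
  unfolding staircase_def by (rule continuous_equivariant_extension) (auto intro!: continuous_intros)

lemma mono_staircase: "mono staircase"
  unfolding staircase_def by (rule mono_equivariant_extension) (auto intro!: mono_onI)

text \<open>
  Both components of the sawtooth depend on the staircase and on \<open>\<mu>\<close> in an affine way. Continuity is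
  then immediate, and so is injectivity: \<open>t\<close> determines the staircase, after which \<open>u\<close> determines \<open>\<mu>\<close>.
\<close>

lemma sawtooth_staircase:
  "sawtooth a1 c n T \<mu> =
     (staircase \<mu> * T, (1 / c) * (- a1 + (real n + 2 * staircase \<mu> - \<mu>) * T))"
proof -
  define i where "i = real_of_int \<lfloor>\<mu> / 2\<rfloor>"
  have R: "staircase \<mu> = i + min 1 (\<mu> - 2 * i)"
    by (simp add: staircase_def equivariant_extension_def i_def)
  show ?thesis
  proof (cases "\<mu> \<le> 2 * i + 1")
    case True
    then have "staircase \<mu> = \<mu> - i" using R by simp
    with True show ?thesis by (simp add: sawtooth_def i_def[symmetric])
  next
    case False
    then have "staircase \<mu> = i + 1" using R by simp
    with False show ?thesis by (simp add: sawtooth_def i_def[symmetric] algebra_simps)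
  qed
qed

lemma staircase_rise:
  assumes "0 \<le> s" "s \<le> 1"
  shows "staircase (2 * of_int j + s) = of_int j + s"
  unfolding staircase_def using assms by (subst equivariant_extension_cell) auto

lemma staircase_flat:
  assumes "1 \<le> s" "s \<le> 2"
  shows "staircase (2 * of_int j + s) = of_int j + 1"
  unfolding staircase_def using assms by (subst equivariant_extension_cell) auto

definition rising_part :: "real set" where
  "rising_part = (\<Union>i::int. {2 * of_int i <..< 2 * of_int i + 1})"

definition falling_part :: "real set" where
  "falling_part = (\<Union>i::int. {2 * of_int i + 1 .. 2 * of_int i + 2})"

lemma rising_part_cell:
  assumes "0 \<le> s" "s < 2"
  shows "2 * of_int j + s \<in> rising_part \<longleftrightarrow> 0 < s \<and> s < 1"
proof
  assume "2 * of_int j + s \<in> rising_part"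
  then obtain i :: int where i: "2 * of_int i < 2 * of_int j + s" "2 * of_int j + s < 2 * of_int i + 1"
    by (auto simp: rising_part_def)
  then have "i = j" using assms by linarith
  then show "0 < s \<and> s < 1" using i by simp
qed (auto simp: rising_part_def intro!: exI[of _ j])

lemma falling_part_cell:
  assumes "0 \<le> s" "s < 2"
  shows "2 * of_int j + s \<in> falling_part \<longleftrightarrow> s = 0 \<or> 1 \<le> s"
proof
  assume "2 * of_int j + s \<in> falling_part"
  then obtain i :: int where i: "2 * of_int i + 1 \<le> 2 * of_int j + s" "2 * of_int j + s \<le> 2 * of_int i + 2"
    by (auto simp: falling_part_def)
  then have "i = j \<or> i = j - 1" using assms by linarith
  then show "s = 0 \<or> 1 \<le> s" using i assms by auto
next
  assume s: "s = 0 \<or> 1 \<le> s"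
  show "2 * of_int j + s \<in> falling_part"
  proof (cases "1 \<le> s")
    case True then show ?thesis using assms by (auto simp: falling_part_def intro!: exI[of _ j])
  next
    case False then show ?thesis using s by (auto simp: falling_part_def intro!: exI[of _ "j - 1"])
  qed
qed

lemma falling_part_complement: "falling_part = - rising_part"
proof -
  have "x \<in> falling_part \<longleftrightarrow> x \<notin> rising_part" for x
  proof -
    obtain j s where x: "x = 2 * of_int j + s" "0 \<le> s" "s < 2" by (rule floor_cell[of 2]) auto
    show ?thesis unfolding x(1) rising_part_cell[OF x(2,3)] falling_part_cell[OF x(2,3)]
      using x by auto
  qed
  then show ?thesis by auto
qed

lemma admissible_sawtooth:
  assumes T: "T > 0" and c: "c > 0"
  shows "admissible_profile (sawtooth a1 c n T) UNIV {} falling_part rising_part"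
proof -
  let ?\<Gamma> = "sawtooth a1 c n T"
  have fst: "fst (?\<Gamma> \<mu>) = staircase \<mu> * T" for \<mu> by (simp add: sawtooth_staircase)
  have snd: "snd (?\<Gamma> \<mu>) = (1 / c) * (- a1 + (real n + 2 * staircase \<mu> - \<mu>) * T)" for \<mu>
    by (simp add: sawtooth_staircase)
  have cont: "continuous_on UNIV ?\<Gamma>"
    unfolding sawtooth_staircase by (intro continuous_intros continuous_staircase)
  have inj: "inj ?\<Gamma>"
    using T c by (intro injI) (auto simp: sawtooth_staircase)
  have mono: "mono_on UNIV (\<lambda>\<mu>. fst (?\<Gamma> \<mu>))"
    using T by (auto simp: fst intro!: mono_onI mult_right_mono monoD[OF mono_staircase])
  have rise: "\<exists>s\<ge>0. s \<le> 1 \<and> x = 2 * of_int i + s"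
    if "x \<in> {2 * of_int i <..< 2 * of_int i + 1}" for x :: real and i :: int
    using that by (intro exI[of _ "x - 2 * of_int i"]) auto
  have fall: "\<exists>s\<ge>1. s \<le> 2 \<and> x = 2 * of_int i + s"
    if "x \<in> {2 * of_int i + 1 .. 2 * of_int i + 2}" for x :: real and i :: int
    using that by (intro exI[of _ "x - 2 * of_int i"]) auto
  have 1: "strict_mono_on {2 * of_int i <..< 2 * of_int i + 1} (\<lambda>\<mu>. fst (?\<Gamma> \<mu>))" for i :: int
  proof (rule strict_mono_onI)
    fix x y :: real assume "x \<in> {2 * of_int i <..< 2 * of_int i + 1}" "y \<in> {2 * of_int i <..< 2 * of_int i + 1}" "x < y"
    then show "fst (?\<Gamma> x) < fst (?\<Gamma> y)"
      using rise[of x i] rise[of y i] T by (auto simp: fst staircase_rise)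
  qed
  have flat: "staircase x = of_int i + 1" if "x \<in> {2 * of_int i + 1 .. 2 * of_int i + 2}" for x and i :: int
    using fall[OF that] by (auto simp: staircase_flat)
  have 2: "(\<lambda>\<mu>. fst (?\<Gamma> \<mu>)) constant_on {2 * of_int i + 1 .. 2 * of_int i + 2}" for i :: int
    by (auto simp: constant_on_def fst flat)
  have 3: "strict_antimono_on {2 * of_int i + 1 .. 2 * of_int i + 2} (\<lambda>\<mu>. snd (?\<Gamma> \<mu>))" for i :: int
    using T c by (auto simp: monotone_on_def snd flat divide_strict_right_mono)
  have disj1: "disjoint (range (\<lambda>i::int. {2 * real_of_int i <..< 2 * of_int i + 1}))"
  proof (rule disjointI, goal_cases)
    case (1 X Y)
    then obtain i j :: int where ij: "X = {2 * real_of_int i <..< 2 * of_int i + 1}"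
      "Y = {2 * real_of_int j <..< 2 * of_int j + 1}" "i \<noteq> j" by blast
    show ?case
    proof (rule ccontr)
      assume "X \<inter> Y \<noteq> {}"
      then obtain x where "x \<in> X" "x \<in> Y" by blast
      then have "i = j" unfolding ij by simp
      then show False using ij by simp
    qed
  qed
  have disj2: "disjoint (range (\<lambda>i::int. {2 * real_of_int i + 1 .. 2 * of_int i + 2}))"
  proof (rule disjointI, goal_cases)
    case (1 X Y)
    then obtain i j :: int where ij: "X = {2 * real_of_int i + 1 .. 2 * of_int i + 2}"
      "Y = {2 * real_of_int j + 1 .. 2 * of_int j + 2}" "i \<noteq> j" by blast
    show ?case
    proof (rule ccontr)
      assume "X \<inter> Y \<noteq> {}"
      then obtain x where "x \<in> X" "x \<in> Y" by blast
      then have "i = j" unfolding ij by simp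
      then show False using ij by simp
    qed
  qed
  have star: "\<exists>\<V>. disjoint \<V> \<and> rising_part = \<Union>\<V> \<and>
        (\<forall>V\<in>\<V>. V \<noteq> {} \<and> is_interval V \<and> openin (top_of_set UNIV) V \<and>
           strict_mono_on V (\<lambda>\<mu>. fst (?\<Gamma> \<mu>)))"
    by (rule exI, rule conjI, rule disj1)
       (auto simp: rising_part_def is_interval_oo 1)
  have minus: "\<exists>\<V>. disjoint \<V> \<and> falling_part = \<Union>\<V> \<and>
        (\<forall>V\<in>\<V>. (\<exists>x\<in>V. \<exists>y\<in>V. x < y) \<and> is_interval V \<and> closedin (top_of_set UNIV) V \<and>
           (\<lambda>\<mu>. fst (?\<Gamma> \<mu>)) constant_on V \<and> strict_antimono_on V (\<lambda>\<mu>. snd (?\<Gamma> \<mu>)))"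
  proof (intro exI conjI, rule disj2)
    show "\<forall>V\<in>range (\<lambda>i::int. {2 * real_of_int i + 1 .. 2 * of_int i + 2}).
       (\<exists>x\<in>V. \<exists>y\<in>V. x < y) \<and> is_interval V \<and> closedin (top_of_set UNIV) V \<and>
           (\<lambda>\<mu>. fst (?\<Gamma> \<mu>)) constant_on V \<and> strict_antimono_on V (\<lambda>\<mu>. snd (?\<Gamma> \<mu>))"
    proof safe
      fix i :: int
      show "\<exists>x\<in>{2 * real_of_int i + 1 .. 2 * of_int i + 2}. \<exists>y\<in>{2 * real_of_int i + 1 .. 2 * of_int i + 2}. x < y"
        by (rule bexI[of _ "2 * of_int i + 1"], rule bexI[of _ "2 * of_int i + 2"]) auto
    qed (use 2 3 in \<open>auto simp: is_interval_cc\<close>)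
  qed (simp add: falling_part_def)
  have plus: "\<exists>\<V>. disjoint \<V> \<and> {} = \<Union>\<V> \<and> (\<forall>V\<in>\<V>. Q V)" for Q :: "real set \<Rightarrow> bool"
    by (rule exI[of _ "{}"]) auto
  show ?thesis
    unfolding admissible_profile_def
    using cont inj mono star minus plus by (auto simp: falling_part_complement disjnt_def)
qed

section \<open>The singular solution carried by the sawtooth\<close>

definition ramp :: "real \<Rightarrow> real \<Rightarrow> real" where
  "ramp l x = max 0 (min l x)"

lemma ramp_cases: "ramp l x = (if x \<le> 0 \<or> l \<le> 0 then 0 else if x \<le> l then x else l)"
  by (auto simp: ramp_def)

lemma ramp_mono: "x \<le> y \<Longrightarrow> ramp l x \<le> ramp l y"
  by (auto simp: ramp_def)

lemma continuous_ramp [continuous_intros]: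
  "continuous_on S f \<Longrightarrow> continuous_on S (\<lambda>x. ramp l (f x))"
  unfolding ramp_def by (intro continuous_intros)

lemma sawtooth_rise:
  assumes "0 \<le> s" "s \<le> 1"
  shows "sawtooth a1 c n T (2 * of_int j + s) =
    ((of_int j + s) * T, (1 / c) * (- a1 + (real n + s) * T))"
  using staircase_rise[OF assms, of j] by (simp add: sawtooth_staircase)

lemma sawtooth_fall:
  assumes "1 \<le> s" "s \<le> 2"
  shows "sawtooth a1 c n T (2 * of_int j + s) =
    ((of_int j + 1) * T, (1 / c) * (- a1 + (real n + 2 - s) * T))"
  using staircase_flat[OF assms, of j] by (simp add: sawtooth_staircase)

lemma sawtooth_shift:
  "sawtooth a1 c n T (\<mu> + 2) = (fst (sawtooth a1 c n T \<mu>) + T, snd (sawtooth a1 c n T \<mu>))"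
proof -
  have "staircase (\<mu> + 2) = staircase \<mu> + 1"
    unfolding staircase_def by (rule equivariant_extension_shift) simp
  then show ?thesis by (simp add: sawtooth_staircase algebra_simps)
qed

text \<open>
  One period of the solution takes \<open>\<eta>\<close> from \<open>0\<close> to \<open>4\<close>, in five phases.
  \<^item> \<open>[0, 1]\<close>: \<open>\<mu>0\<close> runs along a rising segment, \<open>\<mu>1\<close> moves down the last \<open>1 / K1\<close>-th part of a
    falling segment, \<open>\<mu>2\<close> rests.
  \<^item> \<open>[1, 1 + \<theta>]\<close>: \<open>\<mu>0\<close> falls, while \<open>\<mu>1\<close> and \<open>\<mu>2\<close> run along rising segments, until \<open>\<mu>2\<close>
    reaches a jump.
  \<^item> \<open>[1 + \<theta>, 2 + \<theta>]\<close>: \<open>\<mu>0\<close> and \<open>\<mu>1\<close> wait while \<open>\<mu>2\<close> crosses that jump.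
  \<^item> \<open>[2 + \<theta>, 3]\<close>: \<open>\<mu>0\<close> completes its fall, \<open>\<mu>1\<close> its rise, and \<open>\<mu>2\<close> runs along the next rising segment.
  \<^item> \<open>[3, 4]\<close>: \<open>\<mu>0\<close> and \<open>\<mu>2\<close> wait while \<open>\<mu>1\<close> enters a falling segment and moves to the point where the
    first phase needs it.

  The functions \<open>phase0\<close>, \<open>phase1\<close>, \<open>phase2\<close> describe \<open>\<mu>0\<close>, \<open>\<mu>1\<close>, \<open>\<mu>2\<close> on this period. The constant
  terms say that at \<open>\<eta> = 0\<close> the first delayed argument lags \<open>n\<close> periods behind, and the second one
  \<open>n + m + \<theta>\<close>.
\<close>

definition phase0 :: "real \<Rightarrow> real \<Rightarrow> real" where
  "phase0 \<theta> s = ramp (1 + \<theta>) s + ramp (1 - \<theta>) (s - 2 - \<theta>)"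

definition phase1 :: "real \<Rightarrow> real \<Rightarrow> nat \<Rightarrow> real \<Rightarrow> real" where
  "phase1 \<theta> K1 n s = - 2 * real n - 1 / K1 + ramp 1 s / K1 + ramp \<theta> (s - 1)
     + ramp (1 - \<theta>) (s - 2 - \<theta>) + (1 - 1 / K1) * ramp 1 (s - 3)"

definition phase2 :: "real \<Rightarrow> nat \<Rightarrow> nat \<Rightarrow> real \<Rightarrow> real" where
  "phase2 \<theta> n m s = - 2 * (real n + real m + 1) + 1 - \<theta> + ramp 2 (s - 1)"

text \<open>
  The delay equations and the sign of the defect, phase by phase. The first numerical hypothesis on
  \<open>T\<close> is the balance of the equation at the upper end of a rise, when \<open>\<mu>1\<close> is at the lower end of
  its falling segment; it makes the defect vanish during the whole first phase. In the later phases
  the defect, divided by \<open>T / c\<close>, is successively \<open>- (K1 + K2 - 1) r\<close> with \<open>r\<close> up to \<open>\<theta>\<close>, then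
  \<open>K2 r - (K1 + K2 - 1) \<theta>\<close>, then \<open>K2 - (K1 + K2 - 1) r\<close> with \<open>r\<close> from \<open>\<theta>\<close> to \<open>1\<close>, and finally
  \<open>- (K1 - 1) (1 - r)\<close>. The critical moment is when \<open>\<mu>2\<close> has just crossed the jump, and the lower bound
  on \<open>\<theta>\<close> is what keeps the defect negative there.
\<close>

lemma singular_data_cell:
  fixes a1 a2 c K1 K2 T \<theta> s :: real and n m :: nat and j :: int
  assumes T: "T > 0" and c: "c > 0" and K1: "K1 > 1" and K2: "K2 > 0"
    and \<theta>: "\<theta> \<in> {K2 / (K1 + K2 - 1) <..< 1}"
    and Teq: "a1 * (1 + K1 + K2) = T * (real n * (1 + K1 + K2) + 1 + K2 * (1 - \<theta>))"
    and \<theta>eq: "a2 - a1 = (real m + \<theta>) * T"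
    and s: "0 \<le> s" "s \<le> 4"
  defines "\<Gamma> \<equiv> sawtooth a1 c n T"
    and "x0 \<equiv> 2 * of_int j + phase0 \<theta> s"
    and "x1 \<equiv> 2 * of_int j + phase1 \<theta> K1 n s"
    and "x2 \<equiv> 2 * of_int j + phase2 \<theta> n m s"
  shows "fst (\<Gamma> x1) = fst (\<Gamma> x0) - a1 - c * snd (\<Gamma> x0)"
    and "fst (\<Gamma> x2) = fst (\<Gamma> x0) - a2 - c * snd (\<Gamma> x0)"
    and "s \<le> 1 \<Longrightarrow> - snd (\<Gamma> x0) - K1 * snd (\<Gamma> x1) - K2 * snd (\<Gamma> x2) = 0"
    and "1 < s \<Longrightarrow> s < 4 \<Longrightarrow> - snd (\<Gamma> x0) - K1 * snd (\<Gamma> x1) - K2 * snd (\<Gamma> x2) < 0"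
proof -
  have \<theta>0: "0 < \<theta>" "\<theta> < 1" and \<theta>K: "K2 < \<theta> * (K1 + K2 - 1)"
  proof -
    have "0 < K1 + K2 - 1" using K1 K2 by simp
    moreover from this have "0 < K2 / (K1 + K2 - 1)" using K2 by simp
    ultimately show "0 < \<theta>" "\<theta> < 1" "K2 < \<theta> * (K1 + K2 - 1)"
      using \<theta> pos_divide_less_eq[of "K1 + K2 - 1" K2 \<theta>] by auto
  qed
  have rise: "fst (\<Gamma> x) = (of_int i + r) * T" "snd (\<Gamma> x) = (1 / c) * (- a1 + (real n + r) * T)"
    if "x = 2 * of_int i + r" "0 \<le> r" "r \<le> 1" for x r and i :: int
    using sawtooth_rise[OF that(2,3), of a1 c n T i] by (simp_all add: \<Gamma>_def that(1))
  have fall: "fst (\<Gamma> x) = (of_int i + 1) * T" "snd (\<Gamma> x) = (1 / c) * (- a1 + (real n + 2 - r) * T)"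
    if "x = 2 * of_int i + r" "1 \<le> r" "r \<le> 2" for x r and i :: int
    using sawtooth_fall[OF that(2,3), of a1 c n T i] by (simp_all add: \<Gamma>_def that(1))
  let ?F = "- snd (\<Gamma> x0) - K1 * snd (\<Gamma> x1) - K2 * snd (\<Gamma> x2)"
  \<comment> \<open>The heights \<open>p0, p1, p2\<close> are measured from the minimum of \<open>u\<close> in units of \<open>T / c\<close>; \<open>Teq\<close>
     eliminates \<open>a1\<close>.\<close>
  have F: "?F = T / c * f"
    if "snd (\<Gamma> x0) = (1 / c) * (- a1 + (real n + p0) * T)"
       "snd (\<Gamma> x1) = (1 / c) * (- a1 + (real n + p1) * T)"
       "snd (\<Gamma> x2) = (1 / c) * (- a1 + (real n + p2) * T)"
       "f = 1 - p0 - K1 * p1 + K2 * (1 - \<theta> - p2)" for p0 p1 p2 f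
  proof -
    have "?F = (1 / c) * (a1 * (1 + K1 + K2)
            - T * (real n * (1 + K1 + K2) + p0 + K1 * p1 + K2 * p2))"
      unfolding that by (simp add: algebra_simps add_divide_distrib diff_divide_distrib)
    also have "\<dots> = T / c * f" unfolding Teq that(4) by (simp add: algebra_simps add_divide_distrib diff_divide_distrib)
    finally show ?thesis .
  qed
  have neg: "T / c * f < 0" if "f < 0" for f
    using that T c by (intro mult_pos_neg) auto
  have invK1: "0 < 1 / K1" "1 / K1 < 1" using K1 by auto
  consider (A) "s \<le> 1" | (B) "1 < s" "s \<le> 1 + \<theta>" | (C) "1 + \<theta> < s" "s \<le> 2 + \<theta>"
    | (D) "2 + \<theta> < s" "s \<le> 3" | (E) "3 < s" by linarith
  then have "fst (\<Gamma> x1) = fst (\<Gamma> x0) - a1 - c * snd (\<Gamma> x0) \<and>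
    fst (\<Gamma> x2) = fst (\<Gamma> x0) - a2 - c * snd (\<Gamma> x0) \<and>
    (s \<le> 1 \<longrightarrow> ?F = 0) \<and> (1 < s \<and> s < 4 \<longrightarrow> ?F < 0)"
  proof cases
    case A
    have eq0: "x0 = 2 * of_int j + s"
      using A s \<theta>0 by (simp add: x0_def phase0_def ramp_cases)
    note 0 = rise[OF eq0 s(1) A]
    have "s / K1 \<le> 1 / K1" "0 \<le> s / K1" using A K1 s by (auto simp: divide_right_mono)
    then have r1: "1 \<le> 2 - 1 / K1 + s / K1" "2 - 1 / K1 + s / K1 \<le> 2" using invK1 by linarith+
    have eq1: "x1 = 2 * of_int (j - int n - 1) + (2 - 1 / K1 + s / K1)"
      using A s \<theta>0 by (simp add: x1_def phase1_def ramp_cases)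
    note 1 = fall[OF eq1 r1]
    have eq2: "x2 = 2 * of_int (j - int n - int m - 1) + (1 - \<theta>)"
      using A s \<theta>0 by (simp add: x2_def phase2_def ramp_cases)
    have 2: "fst (\<Gamma> x2) = (of_int (j - int n - int m - 1) + (1 - \<theta>)) * T"
      "snd (\<Gamma> x2) = 1 / c * (- a1 + (real n + (1 - \<theta>)) * T)"
      using rise[OF eq2] \<theta>0 by simp_all
    have "?F = T / c * 0"
      by (rule F[of s "(1 - s) / K1" "1 - \<theta>"])
         (use K1 in \<open>simp_all add: 0 1 2 field_simps\<close>)
    then show ?thesis using c \<theta>eq A by (simp add: 0 1 2 algebra_simps)
  next
    case B
    define r where "r = s - 1"
    have r: "0 < r" "r \<le> \<theta>" using B by (auto simp: r_def)
    have eq0: "x0 = 2 * of_int j + (1 + r)"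
      using B s \<theta>0 by (simp add: x0_def phase0_def ramp_cases r_def)
    have 0: "fst (\<Gamma> x0) = (of_int j + 1) * T"
      "snd (\<Gamma> x0) = 1 / c * (- a1 + (real n + 2 - (1 + r)) * T)"
      using fall[OF eq0] r \<theta>0 by simp_all
    have eq1: "x1 = 2 * of_int (j - int n) + r"
      using B s \<theta>0 K1 by (simp add: x1_def phase1_def ramp_cases r_def)
    have 1: "fst (\<Gamma> x1) = (of_int (j - int n) + r) * T"
      "snd (\<Gamma> x1) = 1 / c * (- a1 + (real n + r) * T)"
      using rise[OF eq1] r \<theta>0 by simp_all
    have eq2: "x2 = 2 * of_int (j - int n - int m - 1) + (1 - \<theta> + r)"
      using B s \<theta>0 by (simp add: x2_def phase2_def ramp_cases r_def)
    have 2: "fst (\<Gamma> x2) = (of_int (j - int n - int m - 1) + (1 - \<theta> + r)) * T"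
      "snd (\<Gamma> x2) = 1 / c * (- a1 + (real n + (1 - \<theta> + r)) * T)"
      using rise[OF eq2] \<theta>0 r by simp_all
    have "?F = T / c * (- (K1 + K2 - 1) * r)"
      by (rule F[of "1 - r" r "1 - \<theta> + r"]) (simp_all add: 0 1 2 algebra_simps)
    moreover have "- (K1 + K2 - 1) * r < 0"
      using K1 K2 r by (intro mult_neg_pos) auto
    ultimately have "?F < 0" using neg by simp
    then show ?thesis using c \<theta>eq B by (simp add: 0 1 2 algebra_simps)
  next
    case C
    define r where "r = s - 1 - \<theta>"
    have r: "0 < r" "r \<le> 1" using C by (auto simp: r_def)
    have eq0: "x0 = 2 * of_int j + (1 + \<theta>)"
      using C s \<theta>0 by (simp add: x0_def phase0_def ramp_cases)
    have 0: "fst (\<Gamma> x0) = (of_int j + 1) * T"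
      "snd (\<Gamma> x0) = 1 / c * (- a1 + (real n + 2 - (1 + \<theta>)) * T)"
      using fall[OF eq0] \<theta>0 by simp_all
    have eq1: "x1 = 2 * of_int (j - int n) + \<theta>"
      using C s \<theta>0 K1 by (simp add: x1_def phase1_def ramp_cases)
    have 1: "fst (\<Gamma> x1) = (of_int (j - int n) + \<theta>) * T"
      "snd (\<Gamma> x1) = 1 / c * (- a1 + (real n + \<theta>) * T)"
      using rise[OF eq1] \<theta>0 by simp_all
    have eq2: "x2 = 2 * of_int (j - int n - int m - 1) + (1 + r)"
      using C s \<theta>0 by (simp add: x2_def phase2_def ramp_cases r_def)
    have 2: "fst (\<Gamma> x2) = (of_int (j - int n - int m - 1) + 1) * T"
      "snd (\<Gamma> x2) = 1 / c * (- a1 + (real n + 2 - (1 + r)) * T)"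
      using fall[OF eq2] r by simp_all
    have "?F = T / c * (K2 * r - \<theta> * (K1 + K2 - 1))"
      by (rule F[of "1 - \<theta>" \<theta> "1 - r"]) (simp_all add: 0 1 2 algebra_simps)
    moreover have "K2 * r \<le> K2" using r K2 by (simp add: mult_le_cancel_left1)
    ultimately have "?F < 0" using neg \<theta>K by simp
    then show ?thesis using c \<theta>eq C \<theta>0 by (simp add: 0 1 2 algebra_simps)
  next
    case D
    define r where "r = s - 2"
    have r: "\<theta> < r" "r \<le> 1" using D by (auto simp: r_def)
    have eq0: "x0 = 2 * of_int j + (1 + r)"
      using D s \<theta>0 by (simp add: x0_def phase0_def ramp_cases r_def)
    have 0: "fst (\<Gamma> x0) = (of_int j + 1) * T"
      "snd (\<Gamma> x0) = 1 / c * (- a1 + (real n + 2 - (1 + r)) * T)"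
      using fall[OF eq0] r \<theta>0 by simp_all
    have eq1: "x1 = 2 * of_int (j - int n) + r"
      using D s \<theta>0 K1 by (simp add: x1_def phase1_def ramp_cases r_def)
    have 1: "fst (\<Gamma> x1) = (of_int (j - int n) + r) * T"
      "snd (\<Gamma> x1) = 1 / c * (- a1 + (real n + r) * T)"
      using rise[OF eq1] r \<theta>0 by simp_all
    have eq2: "x2 = 2 * of_int (j - int n - int m) + (r - \<theta>)"
      using D s \<theta>0 by (simp add: x2_def phase2_def ramp_cases r_def)
    have 2: "fst (\<Gamma> x2) = (of_int (j - int n - int m) + (r - \<theta>)) * T"
      "snd (\<Gamma> x2) = 1 / c * (- a1 + (real n + (r - \<theta>)) * T)"
      using rise[OF eq2] \<theta>0 r by simp_all
    have "?F = T / c * (K2 - r * (K1 + K2 - 1))"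
      by (rule F[of "1 - r" r "r - \<theta>"]) (simp_all add: 0 1 2 algebra_simps)
    moreover have "\<theta> * (K1 + K2 - 1) < r * (K1 + K2 - 1)"
      using r K1 K2 by (intro mult_strict_right_mono) auto
    ultimately have "?F < 0" using neg \<theta>K by simp
    then show ?thesis using c \<theta>eq D \<theta>0 by (simp add: 0 1 2 algebra_simps)
  next
    case E
    define r where "r = s - 3"
    have r: "0 < r" "r \<le> 1" using E s by (auto simp: r_def)
    have eq0: "x0 = 2 * of_int j + 2"
      using E s \<theta>0 by (simp add: x0_def phase0_def ramp_cases)
    have 0: "fst (\<Gamma> x0) = (of_int j + 1) * T"
      "snd (\<Gamma> x0) = 1 / c * (- a1 + (real n + 2 - 2) * T)"
      using fall[OF eq0] by simp_all
    have "(1 - 1 / K1) * r \<ge> 0" "(1 - 1 / K1) * r \<le> 1"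
      using r invK1 by (auto intro: mult_le_one)
    then have r1: "1 \<le> 1 + (1 - 1 / K1) * r" "1 + (1 - 1 / K1) * r \<le> 2" by linarith+
    have eq1: "x1 = 2 * of_int (j - int n) + (1 + (1 - 1 / K1) * r)"
      using E s \<theta>0 K1 by (simp add: x1_def phase1_def ramp_cases r_def)
    note 1 = fall[OF eq1 r1]
    have eq2: "x2 = 2 * of_int (j - int n - int m) + (1 - \<theta>)"
      using E s \<theta>0 by (simp add: x2_def phase2_def ramp_cases)
    have 2: "fst (\<Gamma> x2) = (of_int (j - int n - int m) + (1 - \<theta>)) * T"
      "snd (\<Gamma> x2) = 1 / c * (- a1 + (real n + (1 - \<theta>)) * T)"
      using rise[OF eq2] \<theta>0 by simp_all
    have "?F = T / c * (- (K1 - 1) * (1 - r))"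
      by (rule F[of 0 "1 - (1 - 1 / K1) * r" "1 - \<theta>"])
         (use K1 in \<open>simp_all add: 0 1 2 field_simps\<close>)
    moreover have "- (K1 - 1) * (1 - r) < 0" if "s < 4"
      using K1 that by (intro mult_neg_pos) (auto simp: r_def)
    ultimately have "s < 4 \<longrightarrow> ?F < 0" using neg by simp
    then show ?thesis using c \<theta>eq E by (simp add: 0 1 2 algebra_simps)
  qed
  then show "fst (\<Gamma> x1) = fst (\<Gamma> x0) - a1 - c * snd (\<Gamma> x0)"
    and "fst (\<Gamma> x2) = fst (\<Gamma> x0) - a2 - c * snd (\<Gamma> x0)"
    and "s \<le> 1 \<Longrightarrow> ?F = 0" and "1 < s \<Longrightarrow> s < 4 \<Longrightarrow> ?F < 0" by auto
qed

text \<open>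
  The minimum of \<open>u\<close> is attained only at the lower ends of the falling segments. This is what
  excludes periods smaller than \<open>T\<close>.
\<close>

lemma sawtooth_minimum:
  assumes T: "T > 0" and c: "c > 0"
    and eq: "snd (sawtooth a1 c n T \<mu>) = (1 / c) * (- a1 + real n * T)"
  obtains j :: int where "fst (sawtooth a1 c n T \<mu>) = of_int j * T"
proof -
  obtain j s where x: "\<mu> = 2 * of_int j + s" "0 \<le> s" "s < 2" by (rule floor_cell[of 2]) auto
  show thesis
  proof (cases "s \<le> 1")
    case True
    then have "s = 0" using eq T c x sawtooth_rise[of s a1 c n T j] by auto
    then show thesis using that[of j] x sawtooth_rise[of s a1 c n T j] by auto
  next
    case False
    then show thesis using eq T c x sawtooth_fall[of s a1 c n T j] by auto
  qed
qed

text \<open>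
  The defect vanishes on the first phase, which is where \<open>\<mu>0\<close> is on a rising segment; by continuity
  it vanishes on the closure. A point \<open>\<eta>\<close> interior to the set where \<open>\<mu>0\<close> is on a falling segment
  cannot lie in the first phase, endpoints included, since next to it are points
  at which \<open>\<mu>0\<close> is rising. So the strict inequality of the other phases applies. Every period shifts
  a minimum of \<open>u\<close> to a minimum of \<open>u\<close>, and is therefore a multiple of \<open>T\<close>.
\<close>

lemma periodic_singular_solution_sawtooth:
  fixes a1 a2 c K1 K2 T \<theta> :: real and n m :: nat
  assumes T: "T > 0" and c: "c > 0" and K1: "K1 > 1" and K2: "K2 > 0"
    and \<theta>: "\<theta> \<in> {K2 / (K1 + K2 - 1) <..< 1}"
    and Teq: "a1 * (1 + K1 + K2) = T * (real n * (1 + K1 + K2) + 1 + K2 * (1 - \<theta>))"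
    and \<theta>eq: "a2 - a1 = (real m + \<theta>) * T"
  defines "\<mu>0 \<equiv> equivariant_extension 4 2 (phase0 \<theta>)"
    and "\<mu>1 \<equiv> equivariant_extension 4 2 (phase1 \<theta> K1 n)"
    and "\<mu>2 \<equiv> equivariant_extension 4 2 (phase2 \<theta> n m)"
  shows "periodic_singular_solution a1 a2 c K1 K2 (sawtooth a1 c n T) UNIV
     {} falling_part rising_part \<mu>0 \<mu>1 \<mu>2 T"
proof -
  let ?\<Gamma> = "sawtooth a1 c n T"
  let ?F = "defect K1 K2 ?\<Gamma> \<mu>0 \<mu>1 \<mu>2"
  have "0 < K2 / (K1 + K2 - 1)" using K1 K2 by simp
  then have \<theta>0: "0 < \<theta>" "\<theta> < 1" using \<theta> by auto
  have ends: "phase0 \<theta> 4 = phase0 \<theta> 0 + 2" "phase1 \<theta> K1 n 4 = phase1 \<theta> K1 n 0 + 2"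
    "phase2 \<theta> n m 4 = phase2 \<theta> n m 0 + 2"
    using \<theta>0 by (auto simp: phase0_def phase1_def phase2_def ramp_cases)
  have cont: "continuous_on UNIV \<mu>0" "continuous_on UNIV \<mu>1" "continuous_on UNIV \<mu>2"
    unfolding \<mu>0_def \<mu>1_def \<mu>2_def
    by (rule continuous_equivariant_extension;
        use ends in \<open>auto simp: phase0_def[abs_def] phase1_def[abs_def] phase2_def[abs_def]
                          intro!: continuous_intros\<close>;
        use K1 in simp)+
  have mono: "mono_on UNIV \<mu>0"
  proof -
    have "mono_on {0..4} (phase0 \<theta>)"
      by (intro mono_onI) (auto simp: phase0_def intro!: add_mono ramp_mono)
    then show ?thesis unfolding \<mu>0_def
      by (intro mono_equivariant_extension ends(1)) auto
  qed
  have cell: "\<mu>0 (4 * of_int j + s) = 2 * of_int j + phase0 \<theta> s"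
    "\<mu>1 (4 * of_int j + s) = 2 * of_int j + phase1 \<theta> K1 n s"
    "\<mu>2 (4 * of_int j + s) = 2 * of_int j + phase2 \<theta> n m s"
    if "0 \<le> s" "s \<le> 4" for s and j :: int
    unfolding \<mu>0_def \<mu>1_def \<mu>2_def
    using that ends by (auto simp: equivariant_extension_cell)
  note data = singular_data_cell[OF T c K1 K2 \<theta> Teq \<theta>eq]
  have delays: "fst (?\<Gamma> (\<mu>1 \<eta>)) = fst (?\<Gamma> (\<mu>0 \<eta>)) - a1 - c * snd (?\<Gamma> (\<mu>0 \<eta>)) \<and>
            fst (?\<Gamma> (\<mu>2 \<eta>)) = fst (?\<Gamma> (\<mu>0 \<eta>)) - a2 - c * snd (?\<Gamma> (\<mu>0 \<eta>))" for \<eta>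
  proof -
    obtain j s where \<eta>: "\<eta> = 4 * of_int j + s" "0 \<le> s" "s < 4" by (rule floor_cell[of 4]) auto
    then have "s \<le> 4" by simp
    then show ?thesis unfolding \<eta>(1) using data(1,2)[OF \<eta>(2)] cell[OF \<eta>(2)] by simp
  qed
  have F0: "?F (4 * of_int j + s) = 0" if "0 \<le> s" "s \<le> 1" for s and j :: int
    using data(3)[OF that(1), of j] cell[OF that(1), of j] that by (simp add: defect_def)
  have Fneg: "?F (4 * of_int j + s) < 0" if "1 < s" "s < 4" for s and j :: int
    using data(4)[of s j] cell[of s j] that by (simp add: defect_def)
  have contF: "continuous_on UNIV ?F"
  proof -
    have "continuous_on UNIV ?\<Gamma>"
      using admissible_sawtooth[OF T c] by (simp add: admissible_profile_def)
    then have "continuous_on UNIV (\<lambda>\<eta>. ?\<Gamma> (\<mu> \<eta>))" if "continuous_on UNIV \<mu>" for \<mu> :: "real \<Rightarrow> real"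
      using that by (auto intro: continuous_on_compose2)
    then show ?thesis unfolding defect_def[abs_def] using cont by (intro continuous_intros)
  qed
  have rising: "\<mu>0 (4 * of_int j + s) \<in> rising_part \<longleftrightarrow> 0 < s \<and> s < 1" if "0 \<le> s" "s < 4"
    for s and j :: int
  proof (cases "s \<le> 1")
    case True
    then have "phase0 \<theta> s = s" using that \<theta>0 by (simp add: phase0_def ramp_cases)
    then show ?thesis using that True cell(1)[of s j] rising_part_cell[of s j] by simp
  next
    case False
    have "1 \<le> phase0 \<theta> s" "phase0 \<theta> s \<le> 2"
      using False that \<theta>0 by (auto simp: phase0_def ramp_cases)
    then have "2 * of_int j + phase0 \<theta> s \<in> falling_part"
      by (auto simp: falling_part_def intro!: exI[of _ j])
    then show ?thesis using that cell(1)[of s j] False by (simp add: falling_part_complement)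
  qed
  have on_star: "?F \<eta> = 0" if "\<eta> \<in> closure {\<eta>. \<mu>0 \<eta> \<in> rising_part}" for \<eta>
  proof -
    have "{\<eta>. \<mu>0 \<eta> \<in> rising_part} \<subseteq> {\<eta>. ?F \<eta> = 0}"
    proof safe
      fix \<eta> assume *: "\<mu>0 \<eta> \<in> rising_part"
      obtain j s where \<eta>: "\<eta> = 4 * of_int j + s" "0 \<le> s" "s < 4" by (rule floor_cell[of 4]) auto
      then have "s \<le> 1" using rising * by auto
      then show "?F \<eta> = 0" using F0 \<eta> by simp
    qed
    moreover have "closed {\<eta>. ?F \<eta> = 0}"
      using contF by (intro closed_Collect_eq continuous_intros) auto
    ultimately show ?thesis using that closure_minimal by blast
  qed
  have on_minus: "?F \<eta> < 0" if "\<eta> \<in> interior {\<eta>. \<mu>0 \<eta> \<in> falling_part}" for \<eta>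
  proof -
    obtain e where e: "e > 0" "ball \<eta> e \<subseteq> {\<eta>. \<mu>0 \<eta> \<in> falling_part}"
      using \<open>\<eta> \<in> interior _\<close> by (auto simp: mem_interior)
    obtain j s where \<eta>: "\<eta> = 4 * of_int j + s" "0 \<le> s" "s < 4" by (rule floor_cell[of 4]) auto
    have "s > 1"
    proof (rule ccontr)
      assume "\<not> s > 1"
      \<comment> \<open>A point of the open first phase close to \<open>\<eta>\<close>: to the right of \<open>\<eta>\<close> if \<open>s \<le> 1 / 2\<close>,
         to the left otherwise.\<close>
      define h where "h = min (e / 2) (1 / 4)"
      define s' where "s' = (if s \<le> 1 / 2 then s + h else s - h)"
      have h: "0 < h" "h < e" "h \<le> 1 / 4" using e by (auto simp: h_def)
      have s': "0 < s'" "s' < 1" using \<open>\<not> s > 1\<close> h \<eta> by (auto simp: s'_def)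
      have "4 * of_int j + s' \<in> ball \<eta> e"
        using h by (auto simp: \<eta> s'_def dist_real_def)
      then have "\<mu>0 (4 * of_int j + s') \<in> falling_part" using e by blast
      then show False using rising[of s' j] s' by (simp add: falling_part_complement)
    qed
    then show ?thesis using Fneg \<eta> by simp
  qed
  have sol: "singular_solution a1 a2 c K1 K2 ?\<Gamma> UNIV {} falling_part rising_part UNIV \<mu>0 \<mu>1 \<mu>2"
    unfolding singular_solution_def
    using admissible_sawtooth[OF T c] cont mono delays on_star on_minus by auto
  have per: "T \<in> translation_periods ?\<Gamma> \<mu>0 \<mu>1 \<mu>2"
  proof -
    have "\<mu>0 (\<eta> + 4) = \<mu>0 \<eta> + 2" "\<mu>1 (\<eta> + 4) = \<mu>1 \<eta> + 2" "\<mu>2 (\<eta> + 4) = \<mu>2 \<eta> + 2" for \<eta>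
      unfolding \<mu>0_def \<mu>1_def \<mu>2_def by (auto simp: equivariant_extension_shift)
    then show ?thesis
      unfolding translation_periods_def using T by (auto simp: sawtooth_shift intro!: exI[of _ 4])
  qed
  have least: "T \<le> T'" if "T' \<in> translation_periods ?\<Gamma> \<mu>0 \<mu>1 \<mu>2" for T'
  proof -
    have "T' > 0 \<and> (\<exists>p. \<forall>\<eta>. fst (?\<Gamma> (\<mu>0 (\<eta> + p))) = fst (?\<Gamma> (\<mu>0 \<eta>)) + T' \<and>
        snd (?\<Gamma> (\<mu>0 (\<eta> + p))) = snd (?\<Gamma> (\<mu>0 \<eta>)))"
      using that unfolding translation_periods_def by auto
    then obtain p where T': "T' > 0" "fst (?\<Gamma> (\<mu>0 (0 + p))) = fst (?\<Gamma> (\<mu>0 0)) + T'"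
      "snd (?\<Gamma> (\<mu>0 (0 + p))) = snd (?\<Gamma> (\<mu>0 0))"
      by blast
    have "\<mu>0 0 = 0" using cell(1)[of 0 0] \<theta>0 by (simp add: phase0_def ramp_cases)
    then have \<Gamma>0: "?\<Gamma> (\<mu>0 0) = (0, (1 / c) * (- a1 + real n * T))"
      using sawtooth_rise[of 0 a1 c n T 0] by simp
    then obtain j :: int where "fst (?\<Gamma> (\<mu>0 (0 + p))) = of_int j * T"
      using sawtooth_minimum[OF T c, of a1 n] T'(3) by auto
    then have j: "T' = of_int j * T" using T' \<Gamma>0 by simp
    then have "j > 0" using T' T by (simp add: zero_less_mult_iff)
    then have "1 * T \<le> of_int j * T" using T by (intro mult_right_mono) auto
    then show ?thesis using j by simp
  qed
  show ?thesis unfolding periodic_singular_solution_def using sol per least by blast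
qed

section \<open>Reduction to two inequalities\<close>

text \<open>
  The definition of \<open>\<theta>\<close> solves the second identity for \<open>\<theta>\<close>; eliminating \<open>\<theta>\<close> between both
  identities gives a linear equation for \<open>T\<close>, whose solution is \<open>unimodal_T\<close>.
\<close>

lemma unimodal_T_identities:
  fixes a1 a2 K1 K2 :: real and n m :: nat
  assumes a: "0 < a1" "a1 < a2" and K: "0 < K1" "0 < K2"
  defines "T \<equiv> unimodal_T a1 a2 K1 K2 n m" and "\<theta> \<equiv> unimodal_theta a1 a2 K1 K2 n m"
  shows "T > 0" and "a2 - a1 = (real m + \<theta>) * T"
    and "a1 * (1 + K1 + K2) = T * (real n * (1 + K1 + K2) + 1 + K2 * (1 - \<theta>))"
proof -
  let ?D = "1 + (real m + 1) * K2 + real n * (1 + K1 + K2)"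
  have D: "?D > 0" using K by (intro add_pos_nonneg mult_nonneg_nonneg) auto
  show T: "T > 0"
    unfolding T_def unimodal_T_def using a K by (intro divide_pos_pos[OF _ D] add_pos_pos mult_pos_pos) auto
  then show \<theta>: "a2 - a1 = (real m + \<theta>) * T"
    by (simp add: \<theta>_def unimodal_theta_def T_def)
  have "T * ?D = a1 * (1 + K1 + K2) + (a2 - a1) * K2"
    using D by (simp add: T_def unimodal_T_def)
  then have "a1 * (1 + K1 + K2) = T * ?D - ((real m + \<theta>) * T) * K2" unfolding \<theta> by simp
  also have "\<dots> = T * (real n * (1 + K1 + K2) + 1 + K2 * (1 - \<theta>))" by (simp add: algebra_simps)
  finally show "a1 * (1 + K1 + K2) = T * (real n * (1 + K1 + K2) + 1 + K2 * (1 - \<theta>))" .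
qed

lemma unimodal_solution_iff_theta:
  assumes "0 < a1" "a1 < a2" "0 < c" "0 < K2"
  shows "unimodal_solution_at a1 a2 c K2 n m K1 \<longleftrightarrow>
    K1 > 1 \<and> unimodal_theta a1 a2 K1 K2 n m \<in> {K2 / (K1 + K2 - 1) <..< 1}"
proof (cases "K1 > 1 \<and> unimodal_theta a1 a2 K1 K2 n m \<in> {K2 / (K1 + K2 - 1) <..< 1}")
  case True
  then have "0 < K1" by simp
  note id = unimodal_T_identities[where n = n and m = m, OF assms(1,2) this assms(4)]
  show ?thesis
    unfolding unimodal_solution_at_def Let_def
    using True periodic_singular_solution_sawtooth[where n = n and m = m, OF id(1) assms(3) _ assms(4) _ id(3,2)]
    by blast
qed (auto simp: unimodal_solution_at_def)

text \<open>
  The position of \<open>m\<close> relative to \<open>n (A - 1)\<close>. All thresholds become independent of \<open>n\<close> when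
  expressed by it.
\<close>

definition offset :: "real \<Rightarrow> nat \<Rightarrow> nat \<Rightarrow> real" where
  "offset A n m = real m - real n * (A - 1)"

text \<open>
  \<open>G\<close> has linear coefficient \<open>- lin_coeff\<close> in \<open>K1\<close> when it is expanded in \<open>(K1 + K2)\<^sup>2 - 1\<close>, \<open>K1\<close> and
  \<open>1\<close>. For \<open>K2 > 0\<close>, it is positive iff \<open>A > 1 + K2 / (1 + K2)\<close>.
\<close>

definition lin_coeff :: "real \<Rightarrow> real \<Rightarrow> real" where
  "lin_coeff A K2 = (A - 1) * (1 + K2) - K2"

lemma G_nm_offset:
  "G_nm A K2 n m K =
     offset A n m * ((K + K2)^2 - 1) - K * lin_coeff A K2 + K2 * (1 + K2) + (A - 1)"
  by (simp add: G_nm_def offset_def lin_coeff_def)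

lemma G_nm_at_1:
  "G_nm A K2 n m 1 = K2 * ((offset A n m + 1) * (2 + K2) - (A - 1))"
  by (simp add: G_nm_offset lin_coeff_def algebra_simps power2_eq_square)

lemma theta_offset:
  fixes a1 a2 A K1 K2 :: real and n m :: nat
  assumes a: "0 < a1" "a1 < a2" and A: "A = a2 / a1" and K: "0 < K1" "0 < K2"
  defines "S \<equiv> 1 + K1 + K2"
  shows "unimodal_theta a1 a2 K1 K2 n m =
      ((A - 1) * (1 + K2) - offset A n m * S) / (S + (A - 1) * K2)"
    and "0 < S + (A - 1) * K2"
proof -
  have a2: "a2 = A * a1" using a A by simp
  have "A > 1" using a A by simp
  then show N: "0 < S + (A - 1) * K2" using K by (simp add: S_def add_pos_pos)
  define D where "D = 1 + (real m + 1) * K2 + real n * S"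
  have D: "D > 0" unfolding D_def S_def using K by (intro add_pos_nonneg mult_nonneg_nonneg) auto
  have "unimodal_T a1 a2 K1 K2 n m = a1 * (S + (A - 1) * K2) / D"
    by (simp add: unimodal_T_def a2 D_def S_def algebra_simps)
  then have "unimodal_theta a1 a2 K1 K2 n m = (A - 1) * a1 / (a1 * (S + (A - 1) * K2) / D) - real m"
    by (simp add: unimodal_theta_def a2 algebra_simps)
  also have "\<dots> = (A - 1) * D / (S + (A - 1) * K2) - real m"
    using a N D by simp
  also have "\<dots> = ((A - 1) * D - real m * (S + (A - 1) * K2)) / (S + (A - 1) * K2)"
    using N by (simp add: diff_divide_distrib)
  also have "(A - 1) * D - real m * (S + (A - 1) * K2) = (A - 1) * (1 + K2) - offset A n m * S"
    by (simp add: D_def offset_def algebra_simps)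
  finally show "unimodal_theta a1 a2 K1 K2 n m =
      ((A - 1) * (1 + K2) - offset A n m * S) / (S + (A - 1) * K2)" .
qed

text \<open>
  The bound \<open>\<theta> < 1\<close> gives the first inequality. For the lower bound on \<open>\<theta>\<close>, clearing both (positive)
  denominators leaves a difference of two products which expands to \<open>G\<close>.
\<close>

lemma unimodal_solution_iff:
  assumes a: "0 < a1" "a1 < a2" "0 < c" and A: "A = a2 / a1" and K2: "0 < K2"
  shows "unimodal_solution_at a1 a2 c K2 n m K1 \<longleftrightarrow>
    K1 > 1 \<and> A - 1 < (offset A n m + 1) * (1 + K1 + K2) \<and> G_nm A K2 n m K1 < 0"
proof (cases "K1 > 1")
  case True
  let ?S = "1 + K1 + K2" and ?N = "1 + K1 + K2 + (A - 1) * K2" and ?d = "offset A n m"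
  let ?\<theta> = "unimodal_theta a1 a2 K1 K2 n m"
  have K1: "0 < K1" and Q: "0 < K1 + K2 - 1" using True K2 by auto
  note \<theta> = theta_offset(1)[OF a(1,2) A K1 K2, of n m] theta_offset(2)[OF a(1,2) A K1 K2]
  have "?\<theta> < 1 \<longleftrightarrow> (A - 1) * (1 + K2) - ?d * ?S < ?N"
    using \<theta> by (simp add: divide_less_eq)
  also have "\<dots> \<longleftrightarrow> A - 1 < (?d + 1) * ?S" by (auto simp: algebra_simps)
  finally have upper: "?\<theta> < 1 \<longleftrightarrow> A - 1 < (?d + 1) * ?S" .
  have "K2 / (K1 + K2 - 1) < ?\<theta> \<longleftrightarrow>
      K2 * ?N < ((A - 1) * (1 + K2) - ?d * ?S) * (K1 + K2 - 1)"
    unfolding \<theta>(1) using \<theta>(2) Q by (simp add: pos_divide_less_eq pos_less_divide_eq)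
  also have "\<dots> \<longleftrightarrow> G_nm A K2 n m K1 < 0"
  proof -
    have "G_nm A K2 n m K1 = K2 * ?N - ((A - 1) * (1 + K2) - ?d * ?S) * (K1 + K2 - 1)"
      by (simp add: G_nm_offset lin_coeff_def algebra_simps power2_eq_square)
    then show ?thesis by simp
  qed
  finally show ?thesis
    using upper True by (auto simp: unimodal_solution_iff_theta[OF a K2])
qed (simp add: unimodal_solution_at_def)

section \<open>The thresholds in $m$ and $K_1$\<close>

lemma m_zero_bounds:
  "real n * (A - 1) - 1 < real_of_int (m_zero A n)" "real_of_int (m_zero A n) \<le> real n * (A - 1)"
proof -
  have "m_zero A n = \<lfloor>real n * (A - 1)\<rfloor>"
    unfolding m_zero_def
  proof (rule the_equality)
    show "real_of_int \<lfloor>real n * (A - 1)\<rfloor> \<in> {real n * (A - 1) - 1 <.. real n * (A - 1)}"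
      by (simp only: greaterThanAtMost_iff) linarith
  qed (auto intro!: floor_unique[symmetric])
  then show "real n * (A - 1) - 1 < real_of_int (m_zero A n)"
    "real_of_int (m_zero A n) \<le> real n * (A - 1)" by linarith+
qed

lemma L_nm_less_iff:
  assumes "offset A n m > -1"
  shows "L_nm A K2 n m < K \<longleftrightarrow> A - 1 < (offset A n m + 1) * (1 + K + K2)"
proof -
  have "L_nm A K2 n m < K \<longleftrightarrow> (A - 1) / (offset A n m + 1) < 1 + K + K2"
    by (auto simp: L_nm_def offset_def)
  then show ?thesis using assms by (simp add: pos_divide_less_eq mult.commute)
qed

text \<open>
  This rules out \<open>K1 \<le> 1\<close> when \<open>\<delta> \<le> 0\<close> and \<open>K1\<close> exceeds both \<open>L\<close> and the largest root of \<open>G\<close>: either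
  \<open>L \<ge> 1\<close>, or \<open>G\<close> is positive at \<open>1\<close> and that root lies beyond \<open>1\<close>.
\<close>

lemma G_nm_at_1_pos_iff:
  assumes "offset A n m > -1" and "K2 > 0"
  shows "0 < G_nm A K2 n m 1 \<longleftrightarrow> L_nm A K2 n m < 1"
  using assms by (simp add: L_nm_less_iff G_nm_at_1 zero_less_mult_iff)

lemma L_nm_eq_1_iff:
  assumes "offset A n m > -1"
  shows "L_nm A K2 n m = 1 \<longleftrightarrow> A - 1 = (offset A n m + 1) * (2 + K2)"
proof -
  have "L_nm A K2 n m = 1 \<longleftrightarrow> (A - 1) / (offset A n m + 1) = 2 + K2"
    by (auto simp: L_nm_def offset_def)
  then show ?thesis using assms by (simp add: divide_eq_eq mult.commute)
qed

lemma G_nm_at_1_neg_iff: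
  assumes "offset A n m > -1" and "K2 > 0"
  shows "G_nm A K2 n m 1 < 0 \<longleftrightarrow> 1 < L_nm A K2 n m"
  using assms L_nm_less_iff[OF assms(1), of K2 1] L_nm_eq_1_iff[OF assms(1), of K2]
  by (auto simp: G_nm_at_1 mult_less_0_iff)

text \<open>
  \<open>m\<^sup>* = n (A - 1) + (A - 1) / (2 + K2) - 1\<close>, which is the zero in \<open>m\<close> of the bracket in \<open>G_nm_at_1\<close>.
\<close>

lemma m_star_offset:
  assumes "K2 > 0"
  shows "real m < m_star A K2 n \<longleftrightarrow> (offset A n m + 1) * (2 + K2) < A - 1"
    and "real m = m_star A K2 n \<longleftrightarrow> (offset A n m + 1) * (2 + K2) = A - 1"
proof -
  have "m_star A K2 n = real n * (A - 1) + (A - 1) / (2 + K2) - 1"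
    using assms by (simp add: m_star_def field_simps)
  then have "m_star A K2 n - real m = (A - 1) / (2 + K2) - (offset A n m + 1)"
    by (simp add: offset_def)
  then have eq: "(m_star A K2 n - real m) * (2 + K2) = (A - 1) - (offset A n m + 1) * (2 + K2)"
    using assms by (simp only: left_diff_distrib) simp
  have "0 < (m_star A K2 n - real m) * (2 + K2) \<longleftrightarrow> real m < m_star A K2 n"
    "(m_star A K2 n - real m) * (2 + K2) = 0 \<longleftrightarrow> real m = m_star A K2 n"
    using assms by (auto simp: zero_less_mult_iff)
  then show "real m < m_star A K2 n \<longleftrightarrow> (offset A n m + 1) * (2 + K2) < A - 1"
    and "real m = m_star A K2 n \<longleftrightarrow> (offset A n m + 1) * (2 + K2) = A - 1"
    unfolding eq by linarith+
qed

text \<open>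
  At \<open>K1 = L\<close> one has \<open>\<theta> = 1\<close>, and the lower bound \<open>K2 / (K1 + K2 - 1)\<close> is smaller than \<open>1\<close>
  iff \<open>K1 > 1\<close>. In terms of \<open>G\<close> this is the factorization \<open>G L = - (1 + L + K2 + (A - 1) K2) (L - 1)\<close>.
\<close>

lemma G_nm_at_L_neg:
  assumes A: "A > 1" and K2: "K2 > 0" and d: "offset A n m > -1" and L: "L_nm A K2 n m > 1"
  shows "G_nm A K2 n m (L_nm A K2 n m) < 0"
proof -
  let ?d = "offset A n m" and ?L = "L_nm A K2 n m"
  have AL: "A - 1 = (?d + 1) * (1 + ?L + K2)"
    using d by (simp add: L_nm_def offset_def)
  have "G_nm A K2 n m ?L = - (1 + ?L + K2 + (A - 1) * K2) * (?L - 1)"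
    unfolding G_nm_offset lin_coeff_def AL by (simp add: algebra_simps power2_eq_square)
  moreover have "0 < (1 + ?L + K2 + (A - 1) * K2) * (?L - 1)"
    using A K2 L by (intro mult_pos_pos add_pos_pos) auto
  ultimately show ?thesis by (simp only: mult_minus_left neg_less_0_iff_less)
qed

section \<open>The discriminant\<close>

text \<open>
  The discriminant of \<open>G\<close> in \<open>K1\<close> is a quadratic polynomial in \<open>\<delta> = offset A n m\<close>, symmetric about
  \<open>\<delta> = discr_centre A K2 / 2\<close>.
\<close>

definition discr_centre :: "real \<Rightarrow> real \<Rightarrow> real" where
  "discr_centre A K2 = (A - 1) * ((1 + K2)^2 - K2) + K2"

definition G_discr :: "real \<Rightarrow> real \<Rightarrow> nat \<Rightarrow> nat \<Rightarrow> real" where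
  "G_discr A K2 n m =
     (lin_coeff A K2)^2 + 4 * (offset A n m)^2 - 4 * offset A n m * discr_centre A K2"

lemma G_nm_complete_square:
  "4 * offset A n m * G_nm A K2 n m K =
     (2 * offset A n m * (K + K2) - lin_coeff A K2)^2 - G_discr A K2 n m"
  unfolding G_nm_offset G_discr_def
  by (simp add: lin_coeff_def discr_centre_def algebra_simps power2_eq_square)

lemma G_discr_pos_of_sign:
  assumes "offset A n m * G_nm A K2 n m K < 0"
  shows "0 < G_discr A K2 n m"
proof -
  have "4 * offset A n m * G_nm A K2 n m K < 0"
    using assms by (simp add: mult.assoc)
  then show ?thesis
    using zero_le_power2[of "2 * offset A n m * (K + K2) - lin_coeff A K2"]
    unfolding G_nm_complete_square by linarith
qed

text \<open>
  By \<open>G_nm_complete_square\<close> the roots lie symmetrically to \<open>v = lin_coeff / (2 \<delta>) - K2\<close>, at distance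
  \<open>w = \<surd>discriminant / (2 \<bar>\<delta>\<bar>)\<close>. The sum of the roots locates the vertex.
\<close>

lemma G_nm_factorization:
  assumes d: "offset A n m \<noteq> 0" and D: "0 < G_discr A K2 n m"
  shows "G_distinct_roots A K2 n m"
    and "M_minus A K2 n m < M_plus A K2 n m"
    and "\<And>K. G_nm A K2 n m K = offset A n m * (K - M_minus A K2 n m) * (K - M_plus A K2 n m)"
    and "offset A n m * (M_minus A K2 n m + M_plus A K2 n m) =
           lin_coeff A K2 - 2 * offset A n m * K2"
proof -
  let ?d = "offset A n m" and ?D = "G_discr A K2 n m" and ?E = "lin_coeff A K2"
  define w where "w = sqrt ?D / (2 * \<bar>?d\<bar>)"
  define v where "v = ?E / (2 * ?d) - K2"
  have w: "w > 0" using d D by (simp add: w_def)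
  have ww: "4 * ?d^2 * w^2 = ?D"
    using d D by (simp add: w_def power_divide power_mult_distrib)
  have v: "2 * ?d * (K + K2) - ?E = 2 * ?d * (K - v)" for K
    using d by (simp add: v_def field_simps)
  have fac: "G_nm A K2 n m K = ?d * (K - (v - w)) * (K - (v + w))" for K
  proof -
    have "4 * ?d * G_nm A K2 n m K = 4 * ?d * (?d * (K - (v - w)) * (K - (v + w)))"
      unfolding G_nm_complete_square v ww[symmetric]
      by (simp add: algebra_simps power2_eq_square)
    then show ?thesis using d by simp
  qed
  have roots: "{K. G_nm A K2 n m K = 0} = {v - w, v + w}"
    using d by (auto simp: fac)
  have M: "M_minus A K2 n m = v - w" "M_plus A K2 n m = v + w"
    using w by (auto simp: M_minus_def M_plus_def roots)
  show "G_distinct_roots A K2 n m"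
    unfolding G_distinct_roots_def roots using w by (intro exI[of _ "v - w"] exI[of _ "v + w"]) auto
  show "?d * (M_minus A K2 n m + M_plus A K2 n m) = ?E - 2 * ?d * K2"
    using d by (simp add: M v_def field_simps)
  show "M_minus A K2 n m < M_plus A K2 n m"
    and "\<And>K. G_nm A K2 n m K = ?d * (K - M_minus A K2 n m) * (K - M_plus A K2 n m)"
    using w fac by (simp_all add: M)
qed

lemma discr_centre_minus_lin_coeff:
  "discr_centre A K2 - lin_coeff A K2 = (A - 1) * K2^2 + 2 * K2"
  by (simp add: discr_centre_def lin_coeff_def algebra_simps power2_eq_square)

lemma radicand_eq:
  "(1 + (1 + K2)^2) * (((A - 1) * K2 + 1)^2 - 1) = (discr_centre A K2)^2 - (lin_coeff A K2)^2"
  by (simp add: discr_centre_def lin_coeff_def algebra_simps power2_eq_square)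

text \<open>
  The discriminant vanishes at \<open>\<delta> = (C \<plusminus> \<surd>(C\<^sup>2 - E\<^sup>2)) / 2\<close> with \<open>C = discr_centre\<close> and
  \<open>E = lin_coeff\<close>, and the radicand in \<open>m\<^sup>*\<^sup>*\<close> equals \<open>C\<^sup>2 - E\<^sup>2 = (C + E) (C - E)\<close>. So \<open>m\<^sup>*\<^sup>*\<close> belongs
  to the smaller of these two values of \<open>\<delta>\<close>.
\<close>

lemma m_star_star_offset:
  "m_star_star A K2 n = real n * (A - 1) +
     (discr_centre A K2 - sqrt ((discr_centre A K2)^2 - (lin_coeff A K2)^2)) / 2"
  by (simp add: m_star_star_def radicand_eq discr_centre_def add_divide_distrib diff_divide_distrib)

lemma G_discr_alt:
  "G_discr A K2 n m =
     (discr_centre A K2 - 2 * offset A n m)^2 - ((discr_centre A K2)^2 - (lin_coeff A K2)^2)"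
  by (simp add: G_discr_def algebra_simps power2_eq_square)

lemma radicand_nonneg:
  assumes "A > 1" "K2 > 0"
  shows "0 \<le> (discr_centre A K2)^2 - (lin_coeff A K2)^2"
proof -
  have "0 \<le> (A - 1) * K2" using assms by simp
  then have "1 \<le> ((A - 1) * K2 + 1)^2" by (simp add: one_le_power)
  then show ?thesis unfolding radicand_eq[symmetric] by simp
qed

text \<open>
  The second claim says, for \<open>\<delta> > 0\<close>, that the vertex of \<open>G\<close> lies to the right of \<open>1\<close>. It amounts to
  \<open>\<delta> < q\<close> with \<open>q = lin_coeff / (2 (1 + K2))\<close>. At \<open>\<delta> = q\<close> the discriminant is negative, so \<open>q\<close> lies strictly
  between the two zeros of the discriminant, and \<open>\<delta>\<close> is below the smaller one.
\<close>

lemma below_m_star_star: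
  assumes A: "A > 1 + K2 / (1 + K2)" and K2: "K2 > 0" and m: "real m < m_star_star A K2 n"
  shows "0 < G_discr A K2 n m" and "2 * offset A n m * (1 + K2) < lin_coeff A K2"
proof -
  let ?d = "offset A n m" and ?E = "lin_coeff A K2" and ?C = "discr_centre A K2"
  have A1: "A > 1"
  proof -
    have "0 < K2 / (1 + K2)" using K2 by simp
    then show ?thesis using A by linarith
  qed
  have E: "?E > 0" using A K2 by (simp add: lin_coeff_def field_simps)
  have s: "sqrt (?C^2 - ?E^2) < ?C - 2 * ?d"
    using m unfolding m_star_star_offset offset_def by (simp add: field_simps)
  then have "?C^2 - ?E^2 < (?C - 2 * ?d)^2"
    using power_strict_mono[OF s, of 2] radicand_nonneg[OF A1 K2] by simp
  then show "0 < G_discr A K2 n m" by (simp add: G_discr_alt)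
  show "2 * ?d * (1 + K2) < ?E"
  proof (rule ccontr)
    assume "\<not> ?thesis"
    then have "?E / (1 + K2) \<le> 2 * ?d" using K2 by (simp add: field_simps)
    then have "sqrt (?C^2 - ?E^2) < ?C - ?E / (1 + K2)" using s by linarith
    then have "?C^2 - ?E^2 < (?C - ?E / (1 + K2))^2"
      using power_strict_mono[of "sqrt (?C^2 - ?E^2)" "?C - ?E / (1 + K2)" 2]
        radicand_nonneg[OF A1 K2] by simp
    then have "0 < ?E^2 + (?E / (1 + K2))^2 - 2 * ?C * (?E / (1 + K2))"
      by (simp add: algebra_simps power2_eq_square)
    also have "\<dots> = ?E / (1 + K2)^2 * ((1 + K2)^2 * ?E + ?E - 2 * (1 + K2) * ?C)"
      using K2 by (simp add: divide_simps) (simp add: algebra_simps power2_eq_square)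
    also have "(1 + K2)^2 * ?E + ?E - 2 * (1 + K2) * ?C =
        - ((A - 1) * (1 + K2) * K2^2 + K2 * (2 + K2)^2)"
      by (simp add: discr_centre_def lin_coeff_def algebra_simps power2_eq_square)
    finally have "?E / (1 + K2)^2 * ((A - 1) * (1 + K2) * K2^2 + K2 * (2 + K2)^2) < 0"
      unfolding mult_minus_right by linarith
    moreover have "0 < ?E / (1 + K2)^2 * ((A - 1) * (1 + K2) * K2^2 + K2 * (2 + K2)^2)"
      using A1 K2 E by (intro mult_pos_pos add_pos_pos divide_pos_pos) auto
    ultimately show False by linarith
  qed
qed

text \<open>
  With \<open>C = discr_centre\<close> and \<open>E = lin_coeff\<close>, one has \<open>2 \<delta> \<ge> C - \<surd>(C\<^sup>2 - E\<^sup>2) \<ge> 0\<close>. If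
  \<open>E \<le> 0\<close>, every term of \<open>G K\<close> is nonnegative. If \<open>E > 0\<close> and \<open>2 \<delta> < C\<close>, then
  \<open>\<delta>\<close> lies between the zeros of the discriminant, so \<open>G\<close> does not change sign. If
  \<open>2 \<delta> \<ge> C \<ge> max E (A - 1)\<close>, then \<open>G\<close> is nonnegative at \<open>1\<close> and increasing to the right of it.
\<close>

lemma G_nm_nonneg_above_m_star_star:
  assumes A: "A > 1" and K2: "K2 > 0" and m: "real m \<ge> m_star_star A K2 n" and K: "K > 1"
  shows "G_nm A K2 n m K \<ge> 0"
proof -
  let ?d = "offset A n m" and ?E = "lin_coeff A K2" and ?C = "discr_centre A K2"
  have C_eq: "?C = (A - 1) * (1 + K2 + K2^2) + K2"
    by (simp add: discr_centre_def power2_eq_square algebra_simps)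
  have CB: "?C \<ge> A - 1"
  proof -
    have "(A - 1) * 1 \<le> (A - 1) * (1 + K2 + K2^2)" using A K2 by (intro mult_left_mono) auto
    then show ?thesis unfolding C_eq mult_1_right by (rule order_trans) (use K2 in simp)
  qed
  then have C: "?C > 0" using A by linarith
  have CE: "?C \<ge> ?E"
  proof -
    have "0 \<le> (A - 1) * K2^2 + 2 * K2" using A K2 by simp
    then show ?thesis using discr_centre_minus_lin_coeff[of A K2] by linarith
  qed
  have s: "?C - 2 * ?d \<le> sqrt (?C^2 - ?E^2)"
    using m unfolding m_star_star_offset offset_def by (simp add: field_simps)
  have "sqrt (?C^2 - ?E^2) \<le> sqrt (?C^2)" by (intro real_sqrt_le_mono) simp
  then have d0: "?d \<ge> 0" using s C by simp
  have KK: "(K + K2)^2 - 1 \<ge> 0" using K K2 one_le_power[of "K + K2" 2] by simp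
  consider "?E \<le> 0" | "?E > 0" "2 * ?d < ?C" | "?E > 0" "2 * ?d \<ge> ?C" by linarith
  then show ?thesis
  proof cases
    case 1
    then have "K * ?E \<le> 0" using K by (simp add: mult_nonneg_nonpos)
    moreover have "?d * ((K + K2)^2 - 1) \<ge> 0" using d0 KK by (rule mult_nonneg_nonneg)
    moreover have "K2 * (1 + K2) \<ge> 0" using K2 by simp
    ultimately show ?thesis unfolding G_nm_offset using A by linarith
  next
    case 2
    have "(?C - 2 * ?d)^2 \<le> ?C^2 - ?E^2"
      using s 2 radicand_nonneg[OF A K2]
        power_mono[OF s, of 2] by simp
    then have D: "G_discr A K2 n m \<le> 0" by (simp add: G_discr_alt)
    have "?d \<noteq> 0"
      using 2 D by (auto simp: G_discr_def)
    then have "?d > 0" using d0 by simp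
    moreover have "4 * ?d * G_nm A K2 n m K \<ge> 0" unfolding G_nm_complete_square
      using order_trans[OF D zero_le_power2] by simp
    ultimately show ?thesis by (simp add: zero_le_mult_iff)
  next
    case 3
    have dE: "?d * 2 \<ge> ?E" using 3 CE by linarith
    have d: "?d > 0" using 3 dE by linarith
    have "2 * ?d \<le> (?d + 1) * (2 + K2)" using d K2 by (simp add: algebra_simps)
    then have g1: "G_nm A K2 n m 1 \<ge> 0"
      unfolding G_nm_at_1 using K2 3 CB by (intro mult_nonneg_nonneg) auto
    have "G_nm A K2 n m K - G_nm A K2 n m 1 = (K - 1) * (?d * (K + 1 + 2 * K2) - ?E)"
      unfolding G_nm_offset by (simp add: algebra_simps power2_eq_square)
    moreover have "?d * (K + 1 + 2 * K2) \<ge> ?d * 2"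
      using d K K2 by (intro mult_left_mono) auto
    moreover have "(K - 1) * (?d * (K + 1 + 2 * K2) - ?E) \<ge> 0"
      if "?d * (K + 1 + 2 * K2) \<ge> ?d * 2"
      using K dE that by (intro mult_nonneg_nonneg) auto
    ultimately show ?thesis using g1 by linarith
  qed
qed

section \<open>The ranges of $m$\<close>

context
  fixes a1 a2 c A K2 :: real and n m :: nat
  assumes a: "0 < a1" "a1 < a2" "0 < c" and A: "A = a2 / a1" and K2: "0 < K2"
begin

lemma A_gt_1: "A > 1"
  using a A by simp

text \<open>
  For \<open>\<delta> < 0\<close> the parabola opens downwards; it is positive at \<open>- K2\<close>, hence has two roots, and
  is negative beyond the larger one.
\<close>

lemma unimodal_below_breakpoint:
  assumes d: "-1 < offset A n m" "offset A n m < 0"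
  shows "G_distinct_roots A K2 n m"
    and "K1 > max (L_nm A K2 n m) (M_plus A K2 n m) \<Longrightarrow> unimodal_solution_at a1 a2 c K2 n m K1"
proof -
  have "G_nm A K2 n m (- K2) = - offset A n m + (A - 1) * (1 + K2 + K2^2) + K2"
    by (simp add: G_nm_offset lin_coeff_def algebra_simps power2_eq_square)
  also have "\<dots> > 0" using d A_gt_1 K2 by (intro add_pos_pos mult_pos_pos) auto
  finally have "offset A n m * G_nm A K2 n m (- K2) < 0"
    using d by (simp add: mult_neg_pos)
  then have D: "0 < G_discr A K2 n m" by (rule G_discr_pos_of_sign)
  have "offset A n m \<noteq> 0" using d by simp
  note M = G_nm_factorization(2)[OF this D] and fac = G_nm_factorization(3)[OF this D]
  show "G_distinct_roots A K2 n m" by (rule G_nm_factorization(1)) fact+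
  assume K1: "K1 > max (L_nm A K2 n m) (M_plus A K2 n m)"
  have neg: "G_nm A K2 n m K < 0" if "K > M_plus A K2 n m" for K
    unfolding fac using that M d by (simp add: mult_neg_pos)
  have "K1 > 1"
  proof (rule ccontr)
    assume "\<not> K1 > 1"
    then have "L_nm A K2 n m < 1" "M_plus A K2 n m < 1" using K1 by auto
    then show False using neg[of 1] G_nm_at_1_pos_iff[OF d(1) K2] by simp
  qed
  then show "unimodal_solution_at a1 a2 c K2 n m K1"
    using K1 neg L_nm_less_iff[OF d(1), of K2 K1] by (simp add: unimodal_solution_iff[OF a A K2])
qed

text \<open>
  For \<open>\<delta> = 0\<close> both \<open>G\<close> and \<open>L\<close> coincide with those for \<open>n = m = 0\<close>, and \<open>G\<close> is affine in
  \<open>K1\<close>. The hypothesis on \<open>A\<close> says that it is decreasing.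
\<close>

lemma unimodal_at_breakpoint:
  assumes d: "offset A n m = 0" and A': "A > 1 + K2 / (1 + K2)"
  shows "\<exists>!K. G_nm A K2 0 0 K = 0"
    and "K1 > max (L_nm A K2 0 0) (M_root A K2 0 0) \<Longrightarrow> unimodal_solution_at a1 a2 c K2 n m K1"
proof -
  let ?E = "lin_coeff A K2"
  have E: "?E > 0" using A' K2 by (simp add: lin_coeff_def field_simps)
  define r where "r = (K2 * (1 + K2) + (A - 1)) / ?E"
  have d0: "offset A 0 0 = 0" by (simp add: offset_def)
  have lin: "G_nm A K2 0 0 K = ?E * (r - K)" for K
    using E by (simp add: G_nm_offset d0 r_def field_simps)
  show ex1: "\<exists>!K. G_nm A K2 0 0 K = 0"
    using E by (auto simp: lin)
  have root: "M_root A K2 0 0 = r"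
    unfolding M_root_def by (rule the1_equality[OF ex1]) (simp add: lin)
  assume K1: "K1 > max (L_nm A K2 0 0) (M_root A K2 0 0)"
  have same: "G_nm A K2 n m = G_nm A K2 0 0" "L_nm A K2 n m = L_nm A K2 0 0"
    using d by (auto simp: fun_eq_iff G_nm_offset d0 L_nm_def offset_def)
  have neg: "G_nm A K2 n m K < 0" if "K > r" for K
    unfolding same lin using E that by (simp add: mult_pos_neg)
  have d1: "offset A n m > -1" using d by simp
  have "K1 > 1"
  proof (rule ccontr)
    assume "\<not> K1 > 1"
    then have "L_nm A K2 n m < 1" "r < 1" using K1 root same by auto
    then show False using neg[of 1] G_nm_at_1_pos_iff[OF d1 K2] by simp
  qed
  then show "unimodal_solution_at a1 a2 c K2 n m K1"
    using K1 neg[of K1] L_nm_less_iff[OF d1, of K2 K1] same root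
    by (simp add: unimodal_solution_iff[OF a A K2])
qed

text \<open>
  For \<open>\<delta> > 0\<close> the parabola opens upwards, so it is negative exactly between its roots. Of the
  three lower bounds \<open>1\<close>, \<open>L\<close> and the smaller root, \<open>L\<close> is the largest for \<open>m < m\<^sup>*\<close>, all coincide at
  \<open>m = m\<^sup>*\<close>, and for \<open>m\<close> between \<open>m\<^sup>*\<close> and \<open>m\<^sup>*\<^sup>*\<close> the smaller root is the largest,
  provided that \<open>A > 1 + K2 / (1 + K2)\<close>.
\<close>

lemma unimodal_above_breakpoint:
  assumes d: "offset A n m > 0" and D: "0 < G_discr A K2 n m"
    and K1: "K1 > 1" "K1 > L_nm A K2 n m" "K1 \<in> {M_minus A K2 n m <..< M_plus A K2 n m}"
  shows "unimodal_solution_at a1 a2 c K2 n m K1"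
proof -
  have "offset A n m \<noteq> 0" using d by simp
  note fac = G_nm_factorization(3)[OF this D]
  have "G_nm A K2 n m K1 < 0"
    unfolding fac using K1 d by (intro mult_pos_neg mult_pos_pos) auto
  then show ?thesis
    using K1 d L_nm_less_iff[of A n m K2 K1] by (simp add: unimodal_solution_iff[OF a A K2])
qed

lemma unimodal_below_m_star:
  assumes d: "offset A n m > 0" and m: "real m < m_star A K2 n"
  shows "G_distinct_roots A K2 n m \<and> 1 < L_nm A K2 n m \<and> L_nm A K2 n m < M_plus A K2 n m \<and>
    (\<forall>K1 \<in> {L_nm A K2 n m <..< M_plus A K2 n m}. unimodal_solution_at a1 a2 c K2 n m K1)"
proof -
  let ?d = "offset A n m" and ?L = "L_nm A K2 n m"
  have d1: "?d > -1" "?d \<noteq> 0" using d by auto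
  have g1: "G_nm A K2 n m 1 < 0"
    using m K2 by (simp add: m_star_offset G_nm_at_1 mult_pos_neg)
  then have L: "1 < ?L" using G_nm_at_1_neg_iff[OF d1(1) K2] by simp
  have gL: "G_nm A K2 n m ?L < 0" by (rule G_nm_at_L_neg[OF A_gt_1 K2 d1(1) L])
  have D: "0 < G_discr A K2 n m"
    using d gL by (intro G_discr_pos_of_sign[where K = ?L]) (simp add: mult_pos_neg)
  note dist = G_nm_factorization(1)[OF d1(2) D] and M = G_nm_factorization(2)[OF d1(2) D]
    and fac = G_nm_factorization(3)[OF d1(2) D]
  have L_between: "M_minus A K2 n m < ?L" "?L < M_plus A K2 n m"
    using gL d M by (auto simp: fac mult_less_0_iff zero_less_mult_iff)
  show ?thesis
    using dist L L_between by (auto intro!: unimodal_above_breakpoint d D)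
qed

text \<open>
  Here \<open>1\<close> is a root of \<open>G\<close>. It is the smaller one because \<open>G\<close> has negative derivative
  \<open>2 \<delta> (1 + K2) - lin_coeff\<close> at \<open>1\<close>.
\<close>

lemma unimodal_at_m_star:
  assumes d: "offset A n m > 0" and m: "real m = m_star A K2 n"
  shows "G_distinct_roots A K2 n m \<and> 1 = L_nm A K2 n m \<and> L_nm A K2 n m = M_minus A K2 n m \<and>
    M_minus A K2 n m < M_plus A K2 n m \<and>
    (\<forall>K1 \<in> {1 <..< M_plus A K2 n m}. unimodal_solution_at a1 a2 c K2 n m K1)"
proof -
  let ?d = "offset A n m"
  have d1: "?d > -1" "?d \<noteq> 0" using d by auto
  have B: "A - 1 = (?d + 1) * (2 + K2)" using m K2 by (simp add: m_star_offset)
  then have g1: "G_nm A K2 n m 1 = 0" by (simp add: G_nm_at_1)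
  have L: "L_nm A K2 n m = 1" using L_nm_eq_1_iff[OF d1(1)] B by simp
  have "2 * ?d * (1 + K2) - lin_coeff A K2 = - (?d * K2 * (1 + K2) + 2 + 2 * K2 + K2^2)"
    unfolding lin_coeff_def B by (simp add: algebra_simps power2_eq_square)
  also have "\<dots> < 0"
    unfolding neg_less_0_iff_less using d K2 by (intro add_pos_pos mult_pos_pos) auto
  finally have E: "2 * ?d * (1 + K2) < lin_coeff A K2" by simp
  then have "0 < (2 * ?d * (1 + K2) - lin_coeff A K2)^2" by simp
  then have D: "0 < G_discr A K2 n m"
    using G_nm_complete_square[of A n m K2 1] unfolding g1 by linarith
  note dist = G_nm_factorization(1)[OF d1(2) D] and M = G_nm_factorization(2)[OF d1(2) D]
    and fac = G_nm_factorization(3)[OF d1(2) D] and sum = G_nm_factorization(4)[OF d1(2) D]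
  have "?d * 2 < ?d * (M_minus A K2 n m + M_plus A K2 n m)"
    unfolding sum using E by (simp add: algebra_simps)
  then have "2 < M_minus A K2 n m + M_plus A K2 n m" using d by simp
  moreover have "M_minus A K2 n m = 1 \<or> M_plus A K2 n m = 1"
    using g1 d1 by (auto simp: fac)
  ultimately have M1: "M_minus A K2 n m = 1" using M by auto
  show ?thesis
    using dist L M M1 by (auto intro!: unimodal_above_breakpoint d D)
qed

text \<open>
  \<open>G\<close> is positive at \<open>1\<close>, so both roots lie on the same side of \<open>1\<close>; their mean exceeds \<open>1\<close>.
\<close>

lemma unimodal_between_m_star_and_m_star_star:
  assumes d: "offset A n m > 0" and A': "A > 1 + K2 / (1 + K2)"
    and m: "m_star A K2 n < real m" "real m < m_star_star A K2 n"
  shows "G_distinct_roots A K2 n m \<and> 1 \<le> M_minus A K2 n m \<and> M_minus A K2 n m < M_plus A K2 n m \<and>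
    (\<forall>K1 \<in> {M_minus A K2 n m <..< M_plus A K2 n m}. unimodal_solution_at a1 a2 c K2 n m K1)"
proof -
  let ?d = "offset A n m"
  have d1: "?d > -1" "?d \<noteq> 0" using d by auto
  have "A - 1 < (?d + 1) * (2 + K2)"
    using m m_star_offset[OF K2, of m A n] by linarith
  then have g1: "0 < G_nm A K2 n m 1" using K2 by (simp add: G_nm_at_1)
  then have L: "L_nm A K2 n m < 1" using G_nm_at_1_pos_iff[OF d1(1) K2] by simp
  note D = below_m_star_star[OF A' K2 m(2)]
  note dist = G_nm_factorization(1)[OF d1(2) D(1)] and M = G_nm_factorization(2)[OF d1(2) D(1)]
    and fac = G_nm_factorization(3)[OF d1(2) D(1)] and sum = G_nm_factorization(4)[OF d1(2) D(1)]
  have "?d * 2 < ?d * (M_minus A K2 n m + M_plus A K2 n m)"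
    unfolding sum using D(2) by (simp add: algebra_simps)
  then have "2 < M_minus A K2 n m + M_plus A K2 n m" using d by simp
  moreover have "0 < (1 - M_minus A K2 n m) * (1 - M_plus A K2 n m)"
    using g1 d by (simp add: fac mult.assoc zero_less_mult_iff)
  then have "(1 < M_minus A K2 n m \<and> 1 < M_plus A K2 n m) \<or> (M_minus A K2 n m < 1 \<and> M_plus A K2 n m < 1)"
    by (auto simp: zero_less_mult_iff)
  ultimately have M1: "1 < M_minus A K2 n m" by linarith
  show ?thesis
    using dist L M M1 by (auto intro!: unimodal_above_breakpoint d D)
qed

lemma no_unimodal_solution:
  assumes "offset A n m \<le> -1 \<or> real m \<ge> m_star_star A K2 n"
  shows "\<not> unimodal_solution_at a1 a2 c K2 n m K1"
proof
  assume "unimodal_solution_at a1 a2 c K2 n m K1"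
  then have K1: "K1 > 1" and B: "A - 1 < (offset A n m + 1) * (1 + K1 + K2)"
    and G: "G_nm A K2 n m K1 < 0"
    by (auto simp: unimodal_solution_iff[OF a A K2])
  from assms show False
  proof
    assume "offset A n m \<le> -1"
    then have "(offset A n m + 1) * (1 + K1 + K2) \<le> 0"
      using K1 K2 by (intro mult_nonpos_nonneg) auto
    then show False using B A_gt_1 by linarith
  next
    assume "real m \<ge> m_star_star A K2 n"
    then show False using G_nm_nonneg_above_m_star_star[OF A_gt_1 K2 _ K1] G by fastforce
  qed
qed

end

theorem theorem3p1:
  fixes a1 a2 c A K2 :: real and n :: nat
  assumes "0 < a1" and "a1 < a2" and "0 < c" and "A = a2 / a1" and "K2 \<in> {0<..<1}"
  shows
    "(\<forall>m::nat. int m = m_zero A n \<longrightarrow>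
        (real m < real n * (A - 1) \<longrightarrow>
           G_distinct_roots A K2 n m \<and>
           (\<forall>K1 > max (L_nm A K2 n m) (M_plus A K2 n m).
              unimodal_solution_at a1 a2 c K2 n m K1)) \<and>
        (real m = real n * (A - 1) \<and> A > 1 + K2 / (1 + K2) \<longrightarrow>
           (\<exists>!K. G_nm A K2 0 0 K = 0) \<and>
           (\<forall>K1 > max (L_nm A K2 0 0) (M_root A K2 0 0).
              unimodal_solution_at a1 a2 c K2 n m K1)))
   \<and> (\<forall>m::nat. real m \<in> {real n * (A - 1) <..< m_star A K2 n} \<longrightarrow>
        G_distinct_roots A K2 n m \<and>
        1 < L_nm A K2 n m \<and> L_nm A K2 n m < M_plus A K2 n m \<and>
        (\<forall>K1 \<in> {L_nm A K2 n m <..< M_plus A K2 n m}.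
           unimodal_solution_at a1 a2 c K2 n m K1))
   \<and> (\<forall>m::nat. real m = m_star A K2 n \<and> m_star A K2 n > real_of_int (m_zero A n) \<longrightarrow>
        G_distinct_roots A K2 n m \<and>
        1 = L_nm A K2 n m \<and> L_nm A K2 n m = M_minus A K2 n m \<and>
        M_minus A K2 n m < M_plus A K2 n m \<and>
        (\<forall>K1 \<in> {1 <..< M_plus A K2 n m}.
           unimodal_solution_at a1 a2 c K2 n m K1))
   \<and> (A > 1 + K2 / (1 + K2) \<longrightarrow>
      (\<forall>m::nat. int m > m_zero A n \<and> real m \<in> {m_star A K2 n <..< m_star_star A K2 n} \<longrightarrow>
        G_distinct_roots A K2 n m \<and>
        1 \<le> M_minus A K2 n m \<and> M_minus A K2 n m < M_plus A K2 n m \<and>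
        (\<forall>K1 \<in> {M_minus A K2 n m <..< M_plus A K2 n m}.
           unimodal_solution_at a1 a2 c K2 n m K1)))
   \<and> (\<forall>m::nat. int m < m_zero A n \<or> real m \<ge> m_star_star A K2 n \<longrightarrow>
        \<not> (\<exists>K1. unimodal_solution_at a1 a2 c K2 n m K1))"
proof -
  have K2: "0 < K2" using assms by simp
  note unimodal = assms(1-4) K2
  have pos: "offset A n m > 0" if "int m > m_zero A n" for m
  proof -
    have "real m \<ge> real_of_int (m_zero A n) + 1" using that by linarith
    then show ?thesis using m_zero_bounds(1)[of n A] by (simp add: offset_def)
  qed
  have i: "-1 < offset A n m" if "int m = m_zero A n" for m
    using m_zero_bounds(1)[of n A] by (simp add: offset_def flip: that)
  have v: "offset A n m \<le> -1" if "int m < m_zero A n" for m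
  proof -
    have "real m \<le> real_of_int (m_zero A n) - 1" using that by linarith
    then show ?thesis using m_zero_bounds(2)[where n = n and A = A] by (simp add: offset_def)
  qed
  show ?thesis
  proof (intro conjI, goal_cases)
    case 1
    have "offset A n m < 0" if "real m < real n * (A - 1)" for m
      using that by (simp add: offset_def)
    moreover have "offset A n m = 0" if "real m = real n * (A - 1)" for m
      using that by (simp add: offset_def)
    ultimately show ?case
      using unimodal_below_breakpoint[OF unimodal i] unimodal_at_breakpoint[OF unimodal] by blast
  next
    case 2
    show ?case
      using unimodal_below_m_star[OF unimodal] by (simp add: offset_def)
  next
    case 3
    show ?case
    proof (intro allI impI, goal_cases)
      case (1 m)
      then have "int m > m_zero A n" by linarith
      then show ?case using 1 by (intro unimodal_at_m_star[OF unimodal pos]) auto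
    qed
  next
    case 4
    show ?case using unimodal_between_m_star_and_m_star_star[OF unimodal pos] by auto
  next
    case 5
    show ?case using no_unimodal_solution[OF unimodal] v by blast
  qed
qed

end
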